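(* Let $N\ge1$, $1<p<\infty$ and $0<s<1$. Then the space $C_c^\infty(\mathbb{R}^N)$ of smooth functions with compact support is dense in $W^{s+\log,p}(\mathbb{R}^N)$ with respect to the norm $\|\cdot\|_{W^{s+\log,p}(\mathbb{R}^N)}$.
   Context: $W^{s+\log,p}(\mathbb{R}^N)$ is the space of real-valued $u\in L^p(\mathbb{R}^N)$ with $[u]_{s+\log,p}<\infty$, where $$[u]^p_{s+\log,p}=\iint_{\mathbb{R}^{2N}}|u(x)-u(y)|^p\,\mathbf{k}^{s+\log,+}_p(x-y)\,dx\,dy,\qquad\mathbf{k}^{s+\log,+}_p(z)=\frac{C(N,s,p)(-\ln|z|)_+}{|z|^{N+sp}},$$ $(a)_+=\max\{0,a\}$, with norm $\|u\|^p_{W^{s+\log,p}(\mathbb{R}^N)}=\|u\|^p_{L^p(\mathbb{R}^N)}+[u]^p_{s+\log,p}$, and $$C(N,s,p)=\begin{cases}\dfrac{s\,p\,2^{2(s-1)}\,\Gamma\left(\frac{N+sp}{2}\right)}{\pi^{\frac{N-1}{2}}\,\Gamma(1-s)\,\Gamma\left(\frac{p+1}{2}\right)}, & s>\tfrac12,\\[8pt]\dfrac{s\,p\,2^{2s-1}\,\Gamma\left(\frac{N+sp}{2}\right)}{\pi^{\frac N2}\,\Gamma(1-s)}, & s\le\tfrac12.\end{cases}$$ *)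

theory Defs
  imports "HOL-Analysis.Analysis"
begin

definition norm_const :: "nat \<Rightarrow> real \<Rightarrow> real \<Rightarrow> real" where
  "norm_const N s p =
     (if s > 1 / 2
      then s * p * 2 powr (2 * (s - 1)) * Gamma ((real N + s * p) / 2)
           / (pi powr ((real N - 1) / 2) * Gamma (1 - s) * Gamma ((p + 1) / 2))
      else s * p * 2 powr (2 * s - 1) * Gamma ((real N + s * p) / 2)
           / (pi powr (real N / 2) * Gamma (1 - s)))"

text \<open>At the origin, where the formula is undefined, the kernel takes the value 0;
  this concerns only the diagonal in the double integral below, a null set.\<close>

definition log_kernel :: "real \<Rightarrow> real \<Rightarrow> real ^ 'n \<Rightarrow> real" where
  "log_kernel s p z =
     norm_const CARD('n) s p * max 0 (- ln (norm z))
     / norm z powr (real CARD('n) + s * p)"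

definition Lp_norm_pow :: "real \<Rightarrow> (real ^ 'n \<Rightarrow> real) \<Rightarrow> ennreal" where
  "Lp_norm_pow p u = (\<integral>\<^sup>+ x. ennreal (\<bar>u x\<bar> powr p) \<partial>lebesgue)"

definition log_seminorm_pow :: "real \<Rightarrow> real \<Rightarrow> (real ^ 'n \<Rightarrow> real) \<Rightarrow> ennreal" where
  "log_seminorm_pow s p u =
     (\<integral>\<^sup>+ (x, y). ennreal (\<bar>u x - u y\<bar> powr p * log_kernel s p (x - y)) \<partial>lebesgue)"

text \<open>Elements are represented by Lebesgue measurable functions, without passing to classes modulo
  equality almost everywhere; \<open>Wlog_norm\<close> is the (nonnegative, homogeneous) function which
  descends to the norm on the quotient. The power sums are finite on \<open>Wlog\<close>, which is closed under
  differences (\<open>Wlog_diff\<close> below), so that the conversion to a real number is harmless there.\<close>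

definition Wlog :: "real \<Rightarrow> real \<Rightarrow> (real ^ 'n \<Rightarrow> real) set" where
  "Wlog s p = {u \<in> borel_measurable lebesgue. Lp_norm_pow p u < \<infinity> \<and> log_seminorm_pow s p u < \<infinity>}"

definition Wlog_norm :: "real \<Rightarrow> real \<Rightarrow> (real ^ 'n \<Rightarrow> real) \<Rightarrow> real" where
  "Wlog_norm s p u = enn2real (Lp_norm_pow p u + log_seminorm_pow s p u) powr (1 / p)"

text \<open>\<open>Ck k f\<close>: \<open>f\<close> is \<open>k\<close> times continuously differentiable on the whole space, by recursion
  on all directional derivatives.\<close>

primrec Ck :: "nat \<Rightarrow> ('a::euclidean_space \<Rightarrow> 'b::real_normed_vector) \<Rightarrow> bool" where
  "Ck 0 f \<longleftrightarrow> continuous_on UNIV f"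
| "Ck (Suc k) f \<longleftrightarrow>
     (\<forall>x. f differentiable (at x)) \<and> (\<forall>v. Ck k (\<lambda>x. frechet_derivative f (at x) v))"

definition Cc_infinity :: "('a::euclidean_space \<Rightarrow> real) set" where
  "Cc_infinity = {f. (\<forall>k. Ck k f) \<and> compact (closure {x. f x \<noteq> 0})}"


lemma powr_abs_diff_le:
  fixes a b p :: real
  assumes "p > 0"
  shows "\<bar>a - b\<bar> powr p \<le> 2 powr p * (\<bar>a\<bar> powr p + \<bar>b\<bar> powr p)"
proof -
  have "\<bar>a - b\<bar> powr p \<le> (2 * max \<bar>a\<bar> \<bar>b\<bar>) powr p"
    using assms by (intro powr_mono2) auto
  also have "\<dots> = 2 powr p * max \<bar>a\<bar> \<bar>b\<bar> powr p"
    by (simp add: powr_mult)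
  also have "\<dots> \<le> 2 powr p * (\<bar>a\<bar> powr p + \<bar>b\<bar> powr p)"
    by (intro mult_left_mono) (auto simp: max_def)
  finally show ?thesis .
qed

lemma norm_const_nonneg:
  assumes "0 < s" "s < 1" "1 < p"
  shows "norm_const N s p \<ge> 0"
proof -
  have "Gamma ((real N + s * p) / 2) > 0" "Gamma (1 - s) > 0" "Gamma ((p + 1) / 2) > 0"
    using assms by (auto intro!: Gamma_real_pos simp: add_nonneg_pos)
  then show ?thesis
    using assms unfolding norm_const_def by (auto intro!: divide_nonneg_nonneg mult_nonneg_nonneg)
qed

lemma log_kernel_nonneg:
  assumes "0 < s" "s < 1" "1 < p"
  shows "log_kernel s p z \<ge> 0"
  unfolding log_kernel_def using norm_const_nonneg[OF assms] by auto

lemma log_kernel_measurable [measurable]: "log_kernel s p \<in> borel_measurable borel"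
  unfolding log_kernel_def[abs_def] by measurable

lemma lebesgue_measurable_fst_snd:
  fixes u :: "'a::euclidean_space \<Rightarrow> real"
  assumes "u \<in> borel_measurable lebesgue"
  shows "(\<lambda>z :: 'a \<times> 'a. u (fst z)) \<in> borel_measurable lebesgue"
    and "(\<lambda>z :: 'a \<times> 'a. u (snd z)) \<in> borel_measurable lebesgue"
proof -
  obtain v where v [measurable]: "v \<in> borel_measurable lborel" and uv: "AE x in lborel. u x = v x"
    using completion_ex_borel_measurable_real[OF assms] by auto
  from uv obtain M where M: "{x. u x \<noteq> v x} \<subseteq> M" "M \<in> null_sets lborel"
    by (auto elim!: AE_E simp: null_sets_def)
  have "M \<times> UNIV \<in> null_sets (lborel \<Otimes>\<^sub>M (lborel :: 'a measure))"
    "UNIV \<times> M \<in> null_sets ((lborel :: 'a measure) \<Otimes>\<^sub>M lborel)"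
    using M(2) lborel.emeasure_pair_measure_Times[of M lborel UNIV]
      lborel.emeasure_pair_measure_Times[of UNIV lborel M]
    by (auto simp: null_sets_def)
  then have N: "M \<times> UNIV \<in> null_sets (lborel :: ('a \<times> 'a) measure)"
    "UNIV \<times> M \<in> null_sets (lborel :: ('a \<times> 'a) measure)"
    by (simp_all add: lborel_prod)
  have AE: "AE z in lebesgue. v (fst (z :: 'a \<times> 'a)) = u (fst z)"
    "AE z in lebesgue. v (snd (z :: 'a \<times> 'a)) = u (snd z)"
    using M(1) by (intro AE_completion AE_I'[OF N(1)], auto, intro AE_completion AE_I'[OF N(2)], auto)
  have meas: "(\<lambda>z :: 'a \<times> 'a. v (fst z)) \<in> borel_measurable lebesgue"
    "(\<lambda>z :: 'a \<times> 'a. v (snd z)) \<in> borel_measurable lebesgue"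
    by (intro measurable_completion, subst lborel_prod[symmetric], measurable)+
  show "(\<lambda>z :: 'a \<times> 'a. u (fst z)) \<in> borel_measurable lebesgue"
    by (rule borel_measurable_AE[OF meas(1) AE(1)])
  show "(\<lambda>z :: 'a \<times> 'a. u (snd z)) \<in> borel_measurable lebesgue"
    by (rule borel_measurable_AE[OF meas(2) AE(2)])
qed

lemma log_integrand_measurable:
  fixes u :: "real ^ 'n \<Rightarrow> real"
  assumes "u \<in> borel_measurable lebesgue"
  shows "(\<lambda>z. ennreal (\<bar>u (fst z) - u (snd z)\<bar> powr p * log_kernel s p (fst z - snd z)))
           \<in> borel_measurable lebesgue"
proof -
  note [measurable] = lebesgue_measurable_fst_snd[OF assms]
  have [measurable]: "(\<lambda>z :: (real ^ 'n) \<times> (real ^ 'n). log_kernel s p (fst z - snd z))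
      \<in> borel_measurable lebesgue"
    by (intro measurable_completion, subst lborel_prod[symmetric], measurable)
  show ?thesis by measurable
qed

lemma Wlog_diff:
  fixes u v :: "real ^ 'n \<Rightarrow> real"
  assumes sp: "0 < s" "s < 1" "1 < p" and u: "u \<in> Wlog s p" and v: "v \<in> Wlog s p"
  shows "(\<lambda>x. u x - v x) \<in> Wlog s p"
proof -
  have [measurable]: "u \<in> borel_measurable lebesgue" "v \<in> borel_measurable lebesgue"
    using u v by (auto simp: Wlog_def)
  note [measurable] = log_integrand_measurable[of u] log_integrand_measurable[of v]
  let ?c = "ennreal (2 powr p)"
  have "Lp_norm_pow p (\<lambda>x. u x - v x)
      \<le> (\<integral>\<^sup>+ x. ?c * (ennreal (\<bar>u x\<bar> powr p) + ennreal (\<bar>v x\<bar> powr p)) \<partial>lebesgue)"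
    unfolding Lp_norm_pow_def using powr_abs_diff_le[of p] sp
    by (intro nn_integral_mono) (simp flip: ennreal_plus ennreal_mult)
  also have "\<dots> = ?c * (Lp_norm_pow p u + Lp_norm_pow p v)"
    unfolding Lp_norm_pow_def by (simp add: nn_integral_cmult nn_integral_add)
  also have "\<dots> < \<infinity>"
    using u v by (auto simp: Wlog_def ennreal_mult_less_top)
  finally have 1: "Lp_norm_pow p (\<lambda>x. u x - v x) < \<infinity>" .
  let ?g = "\<lambda>w z. ennreal (\<bar>w (fst z) - w (snd z)\<bar> powr p * log_kernel s p (fst z - snd z))"
  have le: "?g (\<lambda>x. u x - v x) z \<le> ?c * (?g u z + ?g v z)" for z
  proof -
    let ?k = "log_kernel s p (fst z - snd z)"
    let ?a = "u (fst z) - u (snd z)" and ?b = "v (fst z) - v (snd z)"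
    have k: "?k \<ge> 0" by (rule log_kernel_nonneg[OF sp])
    have "\<bar>?a - ?b\<bar> powr p * ?k \<le> 2 powr p * (\<bar>?a\<bar> powr p + \<bar>?b\<bar> powr p) * ?k"
      using powr_abs_diff_le[of p ?a ?b] sp k by (intro mult_right_mono) auto
    also have "\<dots> = 2 powr p * (\<bar>?a\<bar> powr p * ?k + \<bar>?b\<bar> powr p * ?k)"
      by (simp add: algebra_simps)
    finally have *: "\<bar>?a - ?b\<bar> powr p * ?k \<le> 2 powr p * (\<bar>?a\<bar> powr p * ?k + \<bar>?b\<bar> powr p * ?k)" .
    have eq: "?a - ?b = u (fst z) - v (fst z) - (u (snd z) - v (snd z))" by simp
    show ?thesis
      using ennreal_leI[OF *] k unfolding eq by (simp add: ennreal_mult)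
  qed
  have "log_seminorm_pow s p (\<lambda>x. u x - v x) \<le> (\<integral>\<^sup>+ z. ?c * (?g u z + ?g v z) \<partial>lebesgue)"
    unfolding log_seminorm_pow_def split_def by (rule nn_integral_mono) (rule le)
  also have "\<dots> = ?c * (log_seminorm_pow s p u + log_seminorm_pow s p v)"
    unfolding log_seminorm_pow_def split_def by (simp add: nn_integral_cmult nn_integral_add)
  also have "\<dots> < \<infinity>"
    using u v by (auto simp: Wlog_def ennreal_mult_less_top)
  finally have 2: "log_seminorm_pow s p (\<lambda>x. u x - v x) < \<infinity>" .
  show ?thesis using 1 2 by (simp add: Wlog_def)
qed

end

theory Submission
  imports Defs "HOL-Real_Asymp.Real_Asymp"
begin

text \<open>
  Both parts of the norm are \<open>L\<^sup>p\<close> norms: that of \<open>u\<close> on \<open>\<real>\<^sup>N\<close>, and that of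
  \<open>(u x - u y) * k(x - y) powr (1 / p)\<close> on \<open>\<real>\<^sup>2\<^sup>N\<close>. The second expression has two decisive features.
  Since the kernel sees only \<open>x - y\<close>, shifting \<open>u\<close> by \<open>h\<close> shifts it by \<open>(h, h)\<close>. And since
  \<open>s * p < p\<close> leaves room to absorb the logarithm, the moment \<open>\<integral>|z| powr p * k(z) dz\<close> is finite
  (\<open>log_kernel_moment_finite\<close>), so that Lipschitz factors neutralise the singularity of the kernel;
  there is no contribution from infinity, as the kernel vanishes for \<open>|z| > 1\<close>.

  The moment bound shows that test functions have finite norm (\<open>Cc_infinity_subset_Wlog\<close>). It also
  yields truncation: if \<open>\<eta>\<close> is a cutoff with Lipschitz constant \<open>1 / n\<close>, the increments of \<open>(1 - \<eta>) u\<close>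
  are those of \<open>u\<close> weighted by \<open>1 - \<eta>\<close>, which are small in the seminorm by dominated convergence, up to a
  term that the moment bounds by a multiple of the \<open>L\<^sup>p\<close> norm of \<open>u\<close> divided by \<open>n\<close>
  (\<open>Wlog_energy_cutoff_tendsto\<close>). The cutoff may be merely Lipschitz because smoothness is supplied afterwards.

  A truncated function \<open>v\<close> is integrable with bounded support, so its convolution with a smooth
  mollifier lies in \<open>Cc_infinity\<close> (\<open>convolution_Cc_infinity\<close>). The convolution is an average of small
  translates of \<open>v\<close>. By Jensen's inequality and Fubini's theorem an average of translates is as close
  in \<open>L\<^sup>p\<close> as the individual translates are (\<open>averaged_translations_Lp\<close>), and these are close because
  translation is continuous in \<open>L\<^sup>p\<close> (\<open>translation_continuous_Lp\<close>). Applied on \<open>\<real>\<^sup>N\<close> and, with diagonal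
  shifts, on \<open>\<real>\<^sup>2\<^sup>N\<close>, this gives convergence in the full norm (\<open>Wlog_energy_mollify\<close>).
\<close>

section \<open>Calculus of C^k functions\<close>

lemma Ck_SucI:
  assumes "\<And>x. (f has_derivative f' x) (at x)" "\<And>v. Ck k (\<lambda>x. f' x v)"
  shows "Ck (Suc k) f"
proof -
  have "frechet_derivative f (at x) = f' x" for x
    using frechet_derivative_at[OF assms(1)] by simp
  then show ?thesis
    using assms by (auto simp: differentiable_def)
qed

lemma Ck_Suc_has_derivative:
  assumes "Ck (Suc k) f"
  shows "(f has_derivative frechet_derivative f (at x)) (at x)"
  using assms frechet_derivative_works by auto

lemma Ck_Suc_imp_Ck: "Ck (Suc k) f \<Longrightarrow> Ck k f"
proof (induction k arbitrary: f)
  case 0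
  then show ?case
    by (auto intro!: continuous_at_imp_continuous_on differentiable_imp_continuous_within)
next
  case (Suc k)
  then show ?case by (metis Ck.simps(2))
qed

lemma Ck_const: "Ck k (\<lambda>x. c)"
proof (induction k arbitrary: c)
  case (Suc k)
  show ?case by (rule Ck_SucI[where f' = "\<lambda>x v. 0"]) (auto intro: Suc)
qed simp

lemma Ck_inner_left: "Ck k (\<lambda>x. x \<bullet> v)"
proof (cases k)
  case (Suc j)
  show ?thesis unfolding Suc
    by (rule Ck_SucI[where f' = "\<lambda>x w. w \<bullet> v"]) (auto intro!: derivative_eq_intros Ck_const)
qed (auto intro!: continuous_intros)

lemma Ck_add: "Ck k f \<Longrightarrow> Ck k g \<Longrightarrow> Ck k (\<lambda>x. f x + g x)"
proof (induction k arbitrary: f g)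
  case (Suc k)
  show ?case
    by (rule Ck_SucI[OF has_derivative_add[OF Ck_Suc_has_derivative Ck_Suc_has_derivative]])
      (use Suc in auto)
qed (auto intro: continuous_intros)

text \<open>
  Leibniz' rule again produces products of functions, but one factor in each is undifferentiated
  and has to be regarded as being of the lower class (\<open>Ck_Suc_imp_Ck\<close>).
\<close>

lemma Ck_mult:
  fixes f g :: "'a::euclidean_space \<Rightarrow> real"
  shows "Ck k f \<Longrightarrow> Ck k g \<Longrightarrow> Ck k (\<lambda>x. f x * g x)"
proof (induction k arbitrary: f g)
  case (Suc k)
  show ?case
  proof (rule Ck_SucI[OF has_derivative_mult[OF Ck_Suc_has_derivative Ck_Suc_has_derivative]])
    show "Ck k (\<lambda>x. f x * frechet_derivative g (at x) v + frechet_derivative f (at x) v * g x)" for v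
      using Suc Ck_Suc_imp_Ck by (intro Ck_add Suc.IH) auto
  qed (use Suc in auto)
qed (auto intro: continuous_intros)

section \<open>Smooth mollifiers\<close>

text \<open>
  The powers of \<open>t\<close> in the denominator make the span of the family closed under
  differentiation; the case \<open>n = 0\<close> is the classical smooth function that vanishes on one half-line.
\<close>

definition flat :: "nat \<Rightarrow> real \<Rightarrow> real" where
  "flat n t = (if t > 0 then exp (- 1 / t) / t ^ n else 0)"

text \<open>
  Away from the origin this is the quotient rule; at the origin the exponential beats every
  power of \<open>t\<close>, so that the difference quotients tend to 0.
\<close>

lemma flat_has_derivative:
  "(flat n has_real_derivative (flat (n + 2) t - real n * flat (n + 1) t)) (at t)"
proof -
  consider "t > 0" | "t < 0" | "t = 0" by linarith
  then show ?thesis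
  proof cases
    case 1
    have "((\<lambda>t. exp (- 1 / t) / t ^ n) has_real_derivative (flat (n + 2) t - real n * flat (n + 1) t)) (at t)"
    proof (cases n)
      case (Suc m)
      have "((\<lambda>t. exp (- 1 / t) / t ^ Suc m) has_real_derivative
          ((exp (- 1 / t) * (1 / t\<^sup>2)) * t ^ Suc m - exp (- 1 / t) * (real (Suc m) * t ^ m)) / (t ^ Suc m * t ^ Suc m)) (at t)"
        using 1 DERIV_power_Suc[OF DERIV_ident, of m t UNIV]
        by (intro DERIV_divide) (auto intro!: derivative_eq_intros simp: power2_eq_square simp del: power_Suc of_nat_Suc)
      also have "((exp (- 1 / t) * (1 / t\<^sup>2)) * t ^ Suc m - exp (- 1 / t) * (real (Suc m) * t ^ m)) / (t ^ Suc m * t ^ Suc m)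
          = flat (n + 2) t - real n * flat (n + 1) t"
        using 1 by (simp add: flat_def Suc field_simps power2_eq_square)
      finally show ?thesis unfolding Suc .
    qed (use 1 in \<open>auto intro!: derivative_eq_intros simp: flat_def power2_eq_square\<close>)
    then show ?thesis
      by (rule DERIV_cong_ev[THEN iffD1, rotated -1, OF _ refl _ refl])
        (use 1 in \<open>auto simp: flat_def intro!: eventually_mono[OF eventually_nhds_in_open[of "{0<..}"]]\<close>)
  next
    case 2
    have "((\<lambda>t. 0) has_real_derivative (flat (n + 2) t - real n * flat (n + 1) t)) (at t)"
      using 2 by (auto simp: flat_def)
    then show ?thesis
      by (rule DERIV_cong_ev[THEN iffD1, rotated -1, OF _ refl _ refl])
        (use 2 in \<open>auto simp: flat_def intro!: eventually_mono[OF eventually_nhds_in_open[of "{..<0}"]]\<close>)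
  next
    case 3
    have "((\<lambda>t. exp (- 1 / t) / t ^ n / t) \<longlongrightarrow> 0) (at_right (0::real))"
      by real_asymp
    then have "((\<lambda>t. flat n t / t) \<longlongrightarrow> 0) (at_right 0)"
      by (rule Lim_transform_eventually)
        (auto simp: flat_def eventually_at_right_less intro!: eventually_mono[OF eventually_at_right_less])
    moreover have "((\<lambda>t. flat n t / t) \<longlongrightarrow> 0) (at_left 0)"
      by (rule tendsto_eventually) (auto simp: flat_def eventually_at_filter)
    ultimately have "((\<lambda>t. flat n t / t) \<longlongrightarrow> 0) (at 0)"
      by (simp add: filterlim_split_at)
    then show ?thesis
      using 3 by (simp add: has_field_derivative_iff flat_def)
  qed
qed

text \<open>
  The derivative with index \<open>n\<close> involves the indices \<open>n + 1\<close> and \<open>n + 2\<close>, multiplied by the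
  linear function \<open>x \<bullet> v\<close>; hence the induction runs over all \<open>n\<close> simultaneously.
\<close>

lemma Ck_flat_sphere:
  fixes r :: real
  shows "Ck k (\<lambda>x::'a::euclidean_space. flat n (r\<^sup>2 - x \<bullet> x))"
proof (induction k arbitrary: n)
  case 0
  have "isCont (flat n) t" for t
    using flat_has_derivative by (rule DERIV_isCont)
  then have "continuous_on UNIV (flat n)"
    by (simp add: continuous_at_imp_continuous_on)
  then show ?case
    by (auto intro!: continuous_intros continuous_on_compose2[of UNIV "flat n"])
next
  case (Suc k)
  let ?q = "\<lambda>x::'a. r\<^sup>2 - x \<bullet> x"
  let ?d = "\<lambda>x. flat (n + 2) (?q x) + (- real n) * flat (n + 1) (?q x)"
  show ?case
  proof (rule Ck_SucI[where f' = "\<lambda>x v. ?d x * (- 2 * (x \<bullet> v))"])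
    fix x :: 'a
    have "(?q has_derivative (\<lambda>v. - 2 * (x \<bullet> v))) (at x)"
      by (auto intro!: derivative_eq_intros simp: inner_commute)
    from has_derivative_compose[OF this flat_has_derivative[unfolded has_field_derivative_def]]
    show "((\<lambda>x. flat n (?q x)) has_derivative (\<lambda>v. ?d x * (- 2 * (x \<bullet> v)))) (at x)"
      by (simp add: ac_simps)
  next
    show "Ck k (\<lambda>x. ?d x * (- 2 * (x \<bullet> v)))" for v
      by (intro Ck_mult Ck_add Ck_const Suc.IH Ck_inner_left)
  qed
qed

lemma Cc_infinity_continuous: "f \<in> Cc_infinity \<Longrightarrow> continuous_on UNIV f"
  unfolding Cc_infinity_def using Ck.simps(1) by blast

lemma Cc_infinity_integrable:
  fixes f :: "'a::euclidean_space \<Rightarrow> real"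
  assumes "f \<in> Cc_infinity"
  shows "integrable lborel f"
proof -
  let ?K = "closure {x. f x \<noteq> 0}"
  have "integrable lborel (\<lambda>x. indicator ?K x *\<^sub>R f x)"
    using assms continuous_on_subset[OF Cc_infinity_continuous[OF assms]]
    by (intro borel_integrable_compact) (auto simp: Cc_infinity_def)
  also have "(\<lambda>x. indicator ?K x *\<^sub>R f x) = f"
    using closure_subset[of "{x. f x \<noteq> 0}"] by (force simp: indicator_def)
  finally show ?thesis .
qed

lemma mollifier_exists:
  fixes r :: real
  assumes "r > 0"
  obtains \<rho> :: "'a::euclidean_space \<Rightarrow> real" where
    "\<rho> \<in> Cc_infinity" "\<And>x. 0 \<le> \<rho> x" "\<And>x. \<rho> x \<noteq> 0 \<Longrightarrow> norm x < r" "integral\<^sup>L lborel \<rho> = 1"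
proof -
  define b :: "'a \<Rightarrow> real" where "b x = flat 0 (r\<^sup>2 - x \<bullet> x)" for x
  have pos: "b x > 0 \<longleftrightarrow> norm x < r" and nonneg: "b x \<ge> 0" for x
    using assms by (auto simp: b_def flat_def power2_norm_eq_inner[symmetric] power_strict_mono
        dest: power_less_imp_less_base)
  have zero: "b x \<noteq> 0 \<longleftrightarrow> norm x < r" for x
    using pos[of x] nonneg[of x] by linarith
  have "{x. b x \<noteq> 0} = ball 0 r"
    by (rule set_eqI) (simp add: zero)
  then have b: "c \<noteq> 0 \<Longrightarrow> (\<lambda>x. b x * c) \<in> Cc_infinity" for c
    using Ck_mult[OF Ck_flat_sphere Ck_const] by (auto simp: Cc_infinity_def b_def)
  have int: "integrable lborel b"
    using Cc_infinity_integrable[OF b[of 1]] by simp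
  define I where "I = integral\<^sup>L lborel b"
  have "I \<noteq> 0"
  proof
    assume "I = 0"
    then have "AE x in lborel. b x = 0"
      unfolding I_def using integral_nonneg_eq_0_iff_AE[OF int] nonneg by simp
    then have "AE x in lborel. x \<notin> ball (0::'a) r"
      by eventually_elim (metis zero mem_ball_0)
    then have "emeasure lborel (ball (0::'a) r) = 0"
      by (subst (asm) AE_iff_measurable[OF _ refl]) (auto simp: ball_def)
    then show False
      using content_ball_pos[OF assms, of "0::'a"] by (simp add: measure_def)
  qed
  moreover have "I \<ge> 0"
    unfolding I_def using nonneg by (intro integral_nonneg_AE) auto
  ultimately have "I > 0" by simp
  show ?thesis
  proof
    show "(\<lambda>x. b x * inverse I) \<in> Cc_infinity"
      using \<open>I > 0\<close> by (intro b) auto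
    show "integral\<^sup>L lborel (\<lambda>x. b x * inverse I) = 1"
      using \<open>I > 0\<close> by (simp add: I_def[symmetric])
  qed (use \<open>I > 0\<close> nonneg zero in auto)
qed

section \<open>Convolution with test functions\<close>

lemma compact_closure_supportI:
  fixes f :: "'a::euclidean_space \<Rightarrow> real"
  assumes "\<And>x. f x \<noteq> 0 \<Longrightarrow> x \<in> K" "compact K"
  shows "compact (closure {x. f x \<noteq> 0})"
proof -
  have "{x. f x \<noteq> 0} \<subseteq> K" using assms(1) by auto
  then show ?thesis
    using bounded_subset[OF compact_imp_bounded[OF assms(2)]] by (simp add: compact_closure)
qed

lemma Cc_infinity_bounded:
  fixes g :: "'a::euclidean_space \<Rightarrow> real"
  assumes "g \<in> Cc_infinity"
  obtains B where "B \<ge> 0" "\<And>x. \<bar>g x\<bar> \<le> B"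
proof -
  let ?K = "closure {x. g x \<noteq> 0}"
  have "bounded (g ` ?K)"
    using assms Cc_infinity_continuous[OF assms]
    by (auto simp: Cc_infinity_def intro!: compact_imp_bounded compact_continuous_image
        intro: continuous_on_subset)
  then obtain B where B: "B > 0" "\<And>x. x \<in> ?K \<Longrightarrow> \<bar>g x\<bar> \<le> B"
    by (auto simp: bounded_pos)
  have "\<bar>g x\<bar> \<le> B" for x
    using B closure_subset[of "{x. g x \<noteq> 0}"] by (cases "g x = 0") auto
  with B that show ?thesis by (meson less_imp_le)
qed

lemma Cc_infinity_has_derivative:
  "g \<in> Cc_infinity \<Longrightarrow> (g has_derivative frechet_derivative g (at x)) (at x)"
  unfolding Cc_infinity_def using Ck_Suc_has_derivative by blast

text \<open>
  Outside the closed support the function is locally 0, so differentiation does not enlarge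
  the closed support.
\<close>

lemma Cc_infinity_derivative:
  fixes g :: "'a::euclidean_space \<Rightarrow> real"
  assumes "g \<in> Cc_infinity"
  shows "(\<lambda>x. frechet_derivative g (at x) v) \<in> Cc_infinity"
proof -
  let ?K = "closure {x. g x \<noteq> 0}"
  have smooth: "Ck k (\<lambda>x. frechet_derivative g (at x) v)" for k
    using assms unfolding Cc_infinity_def by (metis (mono_tags) Ck.simps(2) mem_Collect_eq)
  have vanish: "frechet_derivative g (at x) v = 0" if "x \<notin> ?K" for x
  proof -
    have "((\<lambda>x. 0) has_derivative frechet_derivative g (at x)) (at x)"
      using Cc_infinity_has_derivative[OF assms]
      by (rule has_derivative_transform_within_open[of _ _ _ _ "- ?K"])
        (use that closure_subset[of "{x. g x \<noteq> 0}"] in auto)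
    then show ?thesis
      using has_derivative_unique[OF has_derivative_const] by metis
  qed
  have "compact (closure {x. frechet_derivative g (at x) v \<noteq> 0})"
  proof (rule compact_closure_supportI[rotated])
    show "compact ?K"
      using assms by (simp add: Cc_infinity_def)
  qed (use vanish in blast)
  with smooth show ?thesis
    by (simp add: Cc_infinity_def del: compact_closure)
qed

lemma Cc_infinity_derivative_bounded:
  fixes g :: "'a::euclidean_space \<Rightarrow> real"
  assumes "g \<in> Cc_infinity"
  obtains L where "L \<ge> 0" "\<And>x v. \<bar>frechet_derivative g (at x) v\<bar> \<le> L * norm v"
proof -
  have "\<exists>B. B \<ge> 0 \<and> (\<forall>x. \<bar>frechet_derivative g (at x) b\<bar> \<le> B)" for b
    using Cc_infinity_bounded[OF Cc_infinity_derivative[OF assms]] by metis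
  then obtain B where B: "\<And>b. B b \<ge> 0" "\<And>x b. \<bar>frechet_derivative g (at x) b\<bar> \<le> B b"
    by metis
  show ?thesis
  proof
    show "(\<Sum>b\<in>Basis. B b) \<ge> 0"
      using B by (simp add: sum_nonneg)
    fix x v
    interpret linear "frechet_derivative g (at x)"
      using Cc_infinity_has_derivative[OF assms] by (rule has_derivative_linear)
    have "frechet_derivative g (at x) v = (\<Sum>b\<in>Basis. (v \<bullet> b) * frechet_derivative g (at x) b)"
      by (subst euclidean_representation[of v, symmetric]) (simp add: sum scale)
    also have "\<bar>\<dots>\<bar> \<le> (\<Sum>b\<in>Basis. norm v * B b)"
      using B by (intro order_trans[OF sum_abs] sum_mono) (auto simp: abs_mult Basis_le_norm intro!: mult_mono)
    finally show "\<bar>frechet_derivative g (at x) v\<bar> \<le> (\<Sum>b\<in>Basis. B b) * norm v"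
      by (simp add: sum_distrib_left mult.commute)
  qed
qed

lemma Cc_infinity_lipschitz:
  fixes g :: "'a::euclidean_space \<Rightarrow> real"
  assumes "g \<in> Cc_infinity" "\<And>x v. \<bar>frechet_derivative g (at x) v\<bar> \<le> L * norm v"
  shows "\<bar>g x - g y\<bar> \<le> L * norm (x - y)"
proof -
  have "norm (g x - g y) \<le> L * norm (x - y)"
  proof (rule differentiable_bound[of UNIV g "\<lambda>x. frechet_derivative g (at x)"])
    show "onorm (frechet_derivative g (at x)) \<le> L" for x
      using assms(2) by (intro onorm_le) simp
  qed (use Cc_infinity_has_derivative[OF assms(1)] in auto)
  then show ?thesis by simp
qed

lemma Cc_infinity_measurable: "g \<in> Cc_infinity \<Longrightarrow> g \<in> borel_measurable borel"
  by (rule borel_measurable_continuous_onI[OF Cc_infinity_continuous])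

lemma integrable_bounded_mult:
  fixes f u :: "'a::euclidean_space \<Rightarrow> real"
  assumes "integrable lborel u" "f \<in> borel_measurable borel" "\<And>x. \<bar>f x\<bar> \<le> B"
  shows "integrable lborel (\<lambda>x. f x * u x)"
proof (rule Bochner_Integration.integrable_bound)
  show "integrable lborel (\<lambda>x. B * u x)"
    using assms(1) by simp
  have "B \<ge> 0" using assms(3)[of undefined] by linarith
  then show "AE x in lborel. norm (f x * u x) \<le> norm (B * u x)"
    using assms(3) by (auto simp: abs_mult intro!: mult_right_mono)
qed (use assms in measurable)

lemma convolution_integrable:
  fixes g u :: "'a::euclidean_space \<Rightarrow> real"
  assumes "g \<in> Cc_infinity" "integrable lborel u"
  shows "integrable lborel (\<lambda>y. g (x - y) * u y)"
proof -
  obtain B where B: "\<And>x. \<bar>g x\<bar> \<le> B"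
    using Cc_infinity_bounded[OF assms(1)] by metis
  have "(\<lambda>y. g (x - y)) \<in> borel_measurable borel"
    using Cc_infinity_measurable[OF assms(1)] by measurable
  with B assms show ?thesis
    by (intro integrable_bounded_mult[of _ _ B]) auto
qed

text \<open>
  Difference quotients of \<open>g\<close> deviate from its derivative by at most twice the Lipschitz
  constant, so a multiple of \<open>\<bar>u\<bar>\<close> dominates and the limit may be taken under the integral.
\<close>

lemma convolution_has_derivative:
  fixes g u :: "'a::euclidean_space \<Rightarrow> real"
  assumes g: "g \<in> Cc_infinity" and u: "integrable lborel u"
  shows "((\<lambda>x. \<integral>y. g (x - y) * u y \<partial>lborel) has_derivative
    (\<lambda>v. \<integral>y. frechet_derivative g (at (x - y)) v * u y \<partial>lborel)) (at x)"
proof -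
  define D where "D z = frechet_derivative g (at z)" for z
  obtain L where L: "L \<ge> 0" "\<And>x v. \<bar>D x v\<bar> \<le> L * norm v"
    unfolding D_def using Cc_infinity_derivative_bounded[OF g] by metis
  have lip: "\<bar>g a - g b\<bar> \<le> L * norm (a - b)" for a b
    using Cc_infinity_lipschitz[OF g] L(2) unfolding D_def by blast
  have der: "(g has_derivative D z) (at z)" for z
    unfolding D_def by (rule Cc_infinity_has_derivative[OF g])
  have intg: "integrable lborel (\<lambda>y. g (z - y) * u y)" for z
    by (rule convolution_integrable[OF g u])
  have intD: "integrable lborel (\<lambda>y. D (x - y) v * u y)" for v
    unfolding D_def by (rule convolution_integrable[OF Cc_infinity_derivative[OF g] u])
  have [measurable]: "g \<in> borel_measurable borel" "(\<lambda>z. D z v) \<in> borel_measurable borel" for v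
    using g Cc_infinity_measurable Cc_infinity_derivative by (auto simp: D_def)
  have [measurable]: "u \<in> borel_measurable borel"
    using borel_measurable_integrable[OF u] by simp
  let ?I = "\<lambda>v. \<integral>y. D (x - y) v * u y \<partial>lborel"
  have lin: "linear (D z)" for z
    using der by (rule has_derivative_linear)
  have "bounded_linear ?I"
  proof (rule bounded_linear_intro)
    show "?I (v + w) = ?I v + ?I w" for v w
      by (simp add: linear_add[OF lin] distrib_right intD)
    show "?I (r *\<^sub>R v) = r *\<^sub>R ?I v" for r v
      by (simp add: linear_scale[OF lin] mult.assoc)
    show "norm (?I v) \<le> norm v * (\<integral>y. L * \<bar>u y\<bar> \<partial>lborel)" for v
    proof -
      have "norm (?I v) \<le> (\<integral>y. norm (D (x - y) v * u y) \<partial>lborel)"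
        by (rule integral_norm_bound)
      also have "\<dots> \<le> (\<integral>y. norm v * (L * \<bar>u y\<bar>) \<partial>lborel)"
      proof (rule integral_mono)
        show "integrable lborel (\<lambda>y. norm (D (x - y) v * u y))"
          using intD by (rule integrable_norm)
        show "norm (D (x - y) v * u y) \<le> norm v * (L * \<bar>u y\<bar>)" for y
          using mult_right_mono[OF L(2)[of "x - y" v], of "\<bar>u y\<bar>"] by (simp add: abs_mult ac_simps)
      qed (use u in simp)
      finally show ?thesis by simp
    qed
  qed
  moreover have "((\<lambda>h. norm ((\<integral>y. g (x + h - y) * u y \<partial>lborel) - (\<integral>y. g (x - y) * u y \<partial>lborel) - ?I h)
      / norm h) \<longlongrightarrow> 0) (at 0)"
  proof (unfold tendsto_at_iff_sequentially comp_def, intro allI impI)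
    fix X :: "nat \<Rightarrow> 'a"
    assume X0: "\<forall>i. X i \<in> UNIV - {0}" and X: "X \<longlonglongrightarrow> 0"
    define q where "q i y = (g (x + X i - y) - g (x - y) - D (x - y) (X i)) / norm (X i)" for i y
    have q_lim: "(\<lambda>i. q i y) \<longlonglongrightarrow> 0" for y
    proof -
      have "((\<lambda>h. norm (g (x - y + h) - g (x - y) - D (x - y) h) / norm h) \<longlongrightarrow> 0) (at 0)"
        using der[of "x - y"] by (simp add: has_derivative_at)
      then have "((\<lambda>i. norm (g (x - y + X i) - g (x - y) - D (x - y) (X i)) / norm (X i)) \<longlonglongrightarrow> 0)"
        using X0 X by (auto simp: tendsto_at_iff_sequentially comp_def)
      then have "(\<lambda>i. norm (q i y)) \<longlonglongrightarrow> 0"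
        by (simp add: q_def algebra_simps)
      then show ?thesis by (rule tendsto_norm_zero_cancel)
    qed
    have q_bound: "\<bar>q i y\<bar> \<le> 2 * L" for i y
    proof -
      have "\<bar>g (x + X i - y) - g (x - y) - D (x - y) (X i)\<bar> \<le> 2 * L * norm (X i)"
        using lip[of "x + X i - y" "x - y"] L(2)[of "x - y" "X i"] by simp
      then show ?thesis
        using X0 by (simp add: q_def divide_le_eq)
    qed
    have "(\<lambda>i. \<integral>y. q i y * u y \<partial>lborel) \<longlonglongrightarrow> (\<integral>y. 0 \<partial>(lborel :: 'a measure))"
    proof (rule integral_dominated_convergence[where w = "\<lambda>y. 2 * L * \<bar>u y\<bar>"])
      show "integrable lborel (\<lambda>y. 2 * L * \<bar>u y\<bar>)"
        using u by simp
      show "AE y in lborel. (\<lambda>i. q i y * u y) \<longlonglongrightarrow> 0"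
        using q_lim by (auto intro!: tendsto_mult_left_zero)
      show "AE y in lborel. norm (q i y * u y) \<le> 2 * L * \<bar>u y\<bar>" for i
        using q_bound by (auto simp: abs_mult intro!: mult_right_mono)
    qed (auto simp: q_def)
    moreover have "(\<integral>y. q i y * u y \<partial>lborel) =
      ((\<integral>y. g (x + X i - y) * u y \<partial>lborel) - (\<integral>y. g (x - y) * u y \<partial>lborel) - ?I (X i)) / norm (X i)" for i
      using intg intD by (simp add: q_def left_diff_distrib diff_divide_distrib times_divide_eq_left)
    ultimately show "(\<lambda>i. norm ((\<integral>y. g (x + X i - y) * u y \<partial>lborel) - (\<integral>y. g (x - y) * u y \<partial>lborel) - ?I (X i))
      / norm (X i)) \<longlonglongrightarrow> 0"
      using tendsto_norm_zero[of "\<lambda>i. \<integral>y. q i y * u y \<partial>lborel"] by simp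
  qed
  ultimately show ?thesis
    unfolding has_derivative_at D_def by blast
qed

text \<open>
  The derivative of a convolution is the convolution with a derivative of \<open>g\<close>, which is again
  a test function; the claim is therefore proved for all test functions at once.
\<close>

lemma convolution_Ck:
  fixes g u :: "'a::euclidean_space \<Rightarrow> real"
  assumes "g \<in> Cc_infinity" "integrable lborel u"
  shows "Ck k (\<lambda>x. \<integral>y. g (x - y) * u y \<partial>lborel)"
  using assms(1)
proof (induction k arbitrary: g)
  case 0
  then show ?case
    using convolution_has_derivative[OF 0 assms(2)]
    by (auto intro!: continuous_at_imp_continuous_on has_derivative_continuous)
next
  case (Suc k)
  show ?case
    by (rule Ck_SucI[OF convolution_has_derivative[OF Suc.prems assms(2)]])
      (rule Suc.IH[OF Cc_infinity_derivative[OF Suc.prems]])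
qed

lemma convolution_Cc_infinity:
  fixes g u :: "'a::euclidean_space \<Rightarrow> real"
  assumes g: "g \<in> Cc_infinity" and u: "integrable lborel u"
    and K: "compact K" "\<And>x. u x \<noteq> 0 \<Longrightarrow> x \<in> K"
  shows "(\<lambda>x. \<integral>y. g (x - y) * u y \<partial>lborel) \<in> Cc_infinity"
proof -
  let ?S = "closure {x. g x \<noteq> 0}"
  have "compact ((\<lambda>(x, y). x + y) ` (?S \<times> K))"
    using g K(1) by (intro compact_continuous_image compact_Times)
      (auto simp: Cc_infinity_def split_def intro!: continuous_intros)
  moreover have "x \<in> (\<lambda>(x, y). x + y) ` (?S \<times> K)"
    if "(\<integral>y. g (x - y) * u y \<partial>lborel) \<noteq> 0" for x
  proof -
    have "\<exists>y. g (x - y) * u y \<noteq> 0"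
    proof (rule ccontr)
      assume "\<nexists>y. g (x - y) * u y \<noteq> 0"
      then have "(\<lambda>y. g (x - y) * u y) = (\<lambda>y. 0)" by auto
      with that show False by simp
    qed
    then obtain y where "g (x - y) * u y \<noteq> 0" by blast
    then have "x - y \<in> ?S" "y \<in> K"
      using K(2) closure_subset[of "{x. g x \<noteq> 0}"] by auto
    then show ?thesis by (intro image_eqI[of _ _ "(x - y, y)"]) auto
  qed
  ultimately show ?thesis
    unfolding Cc_infinity_def mem_Collect_eq
    by (intro conjI allI convolution_Ck[OF g u] compact_closure_supportI)
qed

section \<open>Continuity of translations in Lebesgue spaces\<close>

lemma nn_integral_lborel_translate:
  fixes c :: "'a::euclidean_space"
  assumes [measurable]: "f \<in> borel_measurable borel"
  shows "(\<integral>\<^sup>+x. f (x + c) \<partial>lborel) = integral\<^sup>N lborel f"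
proof -
  have "integral\<^sup>N lborel f = integral\<^sup>N (distr lborel borel ((+) c)) f"
    by (simp add: lborel_distr_plus)
  also have "\<dots> = (\<integral>\<^sup>+x. f (c + x) \<partial>lborel)"
    by (subst nn_integral_distr) auto
  finally show ?thesis by (simp add: add.commute)
qed

text \<open>
  Approximation from inside by compact sets holds for finite measures, so it is applied to the
  restriction of Lebesgue measure to \<open>A\<close>.
\<close>

lemma lborel_inner_regular:
  fixes A :: "'a::euclidean_space set" and e :: real
  assumes A: "A \<in> sets borel" "emeasure lborel A < \<infinity>" and e: "e > 0"
  obtains K where "compact K" "K \<subseteq> A" "emeasure lborel (A - K) < ennreal e"
proof (cases "emeasure lborel A = 0")
  case True
  then show ?thesis using that[of "{}"] e by auto
next
  case False
  let ?M = "density lborel (indicator A :: 'a \<Rightarrow> ennreal)"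
  define m where "m = measure lborel A"
  have m: "emeasure lborel A = ennreal m" "m > 0"
  proof -
    show "emeasure lborel A = ennreal m"
      unfolding m_def using A(2) by (intro emeasure_eq_ennreal_measure) auto
    with False have "m \<noteq> 0" by auto
    then show "m > 0" unfolding m_def using measure_nonneg[of lborel A] by linarith
  qed
  have M: "emeasure ?M B = emeasure lborel (A \<inter> B)" if "B \<in> sets borel" for B
    using A(1) that by (subst emeasure_density) (auto simp flip: indicator_inter_arith)
  \<comment> \<open>if \<open>m - e\<close> is negative, it is truncated to 0, which is still below \<open>m\<close>\<close>
  have "ennreal (m - e) < ennreal m"
    using m e by (intro ennreal_lessI) auto
  also have "ennreal m = emeasure ?M A"
    using M[of A] A m by simp
  also have "\<dots> = (SUP K \<in> {K. K \<subseteq> A \<and> compact K}. emeasure ?M K)"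
    using A M[of UNIV] by (intro inner_regular) auto
  finally obtain K where K: "K \<subseteq> A" "compact K" "ennreal (m - e) < emeasure ?M K"
    by (auto simp: less_SUP_iff)
  have KB: "K \<in> sets borel" using K(2) by (simp add: borel_compact)
  have mK: "ennreal (m - e) < emeasure lborel K"
    using K M[OF KB] by (simp add: Int_absorb1)
  have fin: "emeasure lborel K = ennreal (measure lborel K)"
    using emeasure_compact_finite[OF K(2)] by (simp add: emeasure_eq_ennreal_measure)
  have "emeasure lborel (A - K) = emeasure lborel A - emeasure lborel K"
    using K(1) KB A(1) fin by (intro emeasure_Diff) auto
  also have "\<dots> = ennreal (m - measure lborel K)"
    unfolding m(1) fin by (rule ennreal_minus) simp
  also have "m - measure lborel K < e"
  proof (cases "e \<le> m")
    case True
    then show ?thesis using mK unfolding fin by (simp add: ennreal_less_iff)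
  next
    case False
    have "0 \<le> measure lborel K" by (rule measure_nonneg)
    with False show ?thesis by linarith
  qed
  then have "ennreal (m - measure lborel K) < ennreal e"
    using e by (intro ennreal_lessI) auto
  finally show ?thesis using K that by blast
qed

text \<open>
  Enclose \<open>A\<close> between a compact \<open>K\<close> and an open \<open>U\<close>. A translation shorter than the distance
  from \<open>K\<close> to the complement of \<open>U\<close> moves no point of \<open>K\<close> outside \<open>U\<close>, so a point can enter or leave
  \<open>A\<close> only if it or its translate lies in the small set \<open>U - K\<close>.
\<close>

lemma translation_continuous_indicator:
  fixes A :: "'a::euclidean_space set" and e :: real
  assumes A: "A \<in> sets borel" "emeasure lborel A < \<infinity>" and e: "e > 0"
  obtains d where "d > 0"
    "\<And>h. norm h < d \<Longrightarrow> (\<integral>\<^sup>+x. ennreal \<bar>indicator A (x + h) - indicator A x\<bar> \<partial>lborel) < ennreal e"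
proof -
  obtain U where U: "open U" "A \<subseteq> U" "emeasure lborel (U - A) < ennreal (e / 4)"
    using outer_regular_lborel[OF A(1), of "e / 4"] e by auto
  obtain K where K: "compact K" "K \<subseteq> A" "emeasure lborel (A - K) < ennreal (e / 4)"
    using lborel_inner_regular[OF A, of "e / 4"] e by auto
  have [measurable]: "U \<in> sets borel" "K \<in> sets borel"
    using U K by (auto simp: borel_compact)
  let ?D = "U - K"
  have "emeasure lborel ?D \<le> emeasure lborel ((U - A) \<union> (A - K))"
    using A by (intro emeasure_mono) auto
  also have "\<dots> \<le> emeasure lborel (U - A) + emeasure lborel (A - K)"
    using A by (intro emeasure_subadditive) auto
  also have "\<dots> < ennreal (e / 4) + ennreal (e / 4)"
    using U(3) K(3) by (rule add_strict_mono)
  also have "\<dots> = ennreal (e / 2)"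
    using e by (simp flip: ennreal_plus)
  finally have D: "emeasure lborel ?D < ennreal (e / 2)" .
  obtain d where d: "d > 0" "(\<Union>x\<in>K. ball x d) \<subseteq> U"
    using compact_subset_open_imp_ball_epsilon_subset[of K U] U K by blast
  show ?thesis
  proof
    fix h :: 'a assume h: "norm h < d"
    have near: "x + h \<in> U" "x - h \<in> U" if "x \<in> K" for x
      using d(2) that h by (auto simp: dist_norm intro!: subsetD[OF d(2)])
    have "\<bar>indicator A (x + h) - indicator A x\<bar> \<le> indicator ?D (x + h) + (indicator ?D x :: real)" for x
      using near[of x] near[of "x + h"] U(2) K(2) by (auto simp: indicator_def)
    then have "(\<integral>\<^sup>+x. ennreal \<bar>indicator A (x + h) - indicator A x\<bar> \<partial>lborel)
      \<le> (\<integral>\<^sup>+x. ennreal (indicator ?D (x + h)) + ennreal (indicator ?D x) \<partial>lborel)"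
      by (intro nn_integral_mono) (simp flip: ennreal_plus add: ennreal_leI)
    also have "\<dots> = (\<integral>\<^sup>+x. ennreal (indicator ?D (x + h)) \<partial>lborel) + (\<integral>\<^sup>+x. ennreal (indicator ?D x) \<partial>lborel)"
      by (rule nn_integral_add) measurable
    also have "\<dots> = emeasure lborel ?D + emeasure lborel ?D"
      using nn_integral_lborel_translate[of "\<lambda>x. ennreal (indicator ?D x)" h]
      by (simp add: ennreal_indicator)
    also have "\<dots> < ennreal (e / 2) + ennreal (e / 2)"
      using D D by (rule add_strict_mono)
    also have "\<dots> = ennreal e"
      using e by (simp flip: ennreal_plus)
    finally show "(\<integral>\<^sup>+x. ennreal \<bar>indicator A (x + h) - indicator A x\<bar> \<partial>lborel) < ennreal e" .
  qed (rule d(1))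
qed

text \<open>
  The property holds for indicators of sets of finite measure, passes to sums, and passes to
  limits in \<open>L\<^sup>1\<close> because a translated error has the same norm as the error itself.
\<close>

lemma translation_continuous_L1:
  fixes f :: "'a::euclidean_space \<Rightarrow> real" and e :: real
  assumes "integrable lborel f" "e > 0"
  shows "\<exists>d>0. \<forall>h. norm h < d \<longrightarrow> (\<integral>\<^sup>+x. ennreal \<bar>f (x + h) - f x\<bar> \<partial>lborel) < ennreal e"
  using assms
proof (induction arbitrary: e rule: integrable_induct)
  case (base A c)
  show ?case
  proof (cases "c = 0")
    case False
    have "e / \<bar>c\<bar> > 0" using False base by simp
    then obtain d where d: "d > 0" "\<And>h. norm h < d \<Longrightarrow>
        (\<integral>\<^sup>+x. ennreal \<bar>indicator A (x + h) - indicator A x\<bar> \<partial>lborel) < ennreal (e / \<bar>c\<bar>)"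
      using translation_continuous_indicator[of A "e / \<bar>c\<bar>"] base by auto
    have "(\<integral>\<^sup>+x. ennreal \<bar>indicator A (x + h) *\<^sub>R c - indicator A x *\<^sub>R c\<bar> \<partial>lborel) < ennreal e"
      if "norm h < d" for h
    proof -
      have [measurable]: "A \<in> sets borel" using base by simp
      have "(\<integral>\<^sup>+x. ennreal \<bar>indicator A (x + h) *\<^sub>R c - indicator A x *\<^sub>R c\<bar> \<partial>lborel)
        = (\<integral>\<^sup>+x. ennreal \<bar>c\<bar> * ennreal \<bar>indicator A (x + h) - indicator A x\<bar> \<partial>lborel)"
      proof (intro nn_integral_cong)
        fix x
        have "\<bar>indicator A (x + h) *\<^sub>R c - indicator A x *\<^sub>R c\<bar>
          = \<bar>c\<bar> * \<bar>indicator A (x + h) - indicator A x\<bar>"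
          by (simp add: abs_mult[symmetric] algebra_simps)
        then show "ennreal \<bar>indicator A (x + h) *\<^sub>R c - indicator A x *\<^sub>R c\<bar>
          = ennreal \<bar>c\<bar> * ennreal \<bar>indicator A (x + h) - indicator A x\<bar>"
          by (simp add: ennreal_mult)
      qed
      also have "\<dots> = ennreal \<bar>c\<bar> * (\<integral>\<^sup>+x. ennreal \<bar>indicator A (x + h) - indicator A x\<bar> \<partial>lborel)"
        by (rule nn_integral_cmult) measurable
      also have "\<dots> < ennreal \<bar>c\<bar> * ennreal (e / \<bar>c\<bar>)"
        using d(2)[OF that] False by (intro ennreal_mult_strict_left_mono) auto
      also have "\<dots> = ennreal e"
        using False by (simp flip: ennreal_mult')
      finally show ?thesis .
    qed
    with d(1) show ?thesis by blast
  qed (use base in \<open>auto intro!: exI[of _ 1]\<close>)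
next
  case (add f g)
  have [measurable]: "f \<in> borel_measurable borel" "g \<in> borel_measurable borel"
    using add.hyps borel_measurable_integrable by auto
  have e2: "e / 2 > 0" using add.prems by simp
  obtain d where d: "d > 0" "\<And>h. norm h < d \<Longrightarrow> (\<integral>\<^sup>+x. ennreal \<bar>f (x + h) - f x\<bar> \<partial>lborel) < ennreal (e / 2)"
    using add.IH(1)[OF e2] by blast
  obtain d' where d': "d' > 0" "\<And>h. norm h < d' \<Longrightarrow> (\<integral>\<^sup>+x. ennreal \<bar>g (x + h) - g x\<bar> \<partial>lborel) < ennreal (e / 2)"
    using add.IH(2)[OF e2] by blast
  have "(\<integral>\<^sup>+x. ennreal \<bar>f (x + h) + g (x + h) - (f x + g x)\<bar> \<partial>lborel) < ennreal e"
    if "norm h < min d d'" for h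
  proof -
    have "(\<integral>\<^sup>+x. ennreal \<bar>f (x + h) + g (x + h) - (f x + g x)\<bar> \<partial>lborel)
      \<le> (\<integral>\<^sup>+x. ennreal \<bar>f (x + h) - f x\<bar> + ennreal \<bar>g (x + h) - g x\<bar> \<partial>lborel)"
      by (intro nn_integral_mono) (simp flip: ennreal_plus add: ennreal_leI)
    also have "\<dots> = (\<integral>\<^sup>+x. ennreal \<bar>f (x + h) - f x\<bar> \<partial>lborel) + (\<integral>\<^sup>+x. ennreal \<bar>g (x + h) - g x\<bar> \<partial>lborel)"
      by (rule nn_integral_add) measurable
    also have "\<dots> < ennreal (e / 2) + ennreal (e / 2)"
      using d(2)[of h] d'(2)[of h] that by (intro add_strict_mono) auto
    also have "\<dots> = ennreal e"
      using add.prems by (simp flip: ennreal_plus)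
    finally show ?thesis .
  qed
  with d(1) d'(1) show ?case by (intro exI[of _ "min d d'"]) auto
next
  case (lim f s)
  have [measurable]: "f \<in> borel_measurable borel" "s i \<in> borel_measurable borel" for i
    using lim.hyps borel_measurable_integrable by auto
  have "(\<lambda>i. (\<integral>\<^sup>+x. norm (f x - s i x) \<partial>lborel)) \<longlonglongrightarrow> 0"
  proof (rule nn_integral_dominated_convergence_norm[where w = "\<lambda>x. 2 * \<bar>f x\<bar>"])
    show "(\<integral>\<^sup>+x. ennreal (2 * \<bar>f x\<bar>) \<partial>lborel) < \<infinity>"
      using lim.hyps(4) by (simp add: integrable_iff_bounded ennreal_mult nn_integral_cmult ennreal_mult_less_top)
  qed (use lim.hyps in auto)
  then have "\<forall>\<^sub>F i in sequentially. (\<integral>\<^sup>+x. norm (f x - s i x) \<partial>lborel) < ennreal (e / 4)"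
    using lim.prems by (intro order_tendstoD(2)) auto
  then obtain i where i: "(\<integral>\<^sup>+x. ennreal \<bar>f x - s i x\<bar> \<partial>lborel) < ennreal (e / 4)"
    by (auto simp: eventually_sequentially)
  obtain d where d: "d > 0" "\<And>h. norm h < d \<Longrightarrow> (\<integral>\<^sup>+x. ennreal \<bar>s i (x + h) - s i x\<bar> \<partial>lborel) < ennreal (e / 2)"
    using lim.IH[of "e / 2" i] lim.prems by auto
  have "(\<integral>\<^sup>+x. ennreal \<bar>f (x + h) - f x\<bar> \<partial>lborel) < ennreal e" if h: "norm h < d" for h
  proof -
    let ?r = "\<lambda>x. ennreal \<bar>f x - s i x\<bar>"
    have "\<bar>f (x + h) - f x\<bar> \<le> \<bar>f (x + h) - s i (x + h)\<bar> + \<bar>f x - s i x\<bar> + \<bar>s i (x + h) - s i x\<bar>" for x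
      by linarith
    then have "(\<integral>\<^sup>+x. ennreal \<bar>f (x + h) - f x\<bar> \<partial>lborel)
      \<le> (\<integral>\<^sup>+x. (?r (x + h) + ?r x) + ennreal \<bar>s i (x + h) - s i x\<bar> \<partial>lborel)"
      by (intro nn_integral_mono) (simp flip: ennreal_plus add: ennreal_leI)
    also have "\<dots> = (\<integral>\<^sup>+x. ?r (x + h) + ?r x \<partial>lborel) + (\<integral>\<^sup>+x. ennreal \<bar>s i (x + h) - s i x\<bar> \<partial>lborel)"
      by (rule nn_integral_add) measurable
    also have "(\<integral>\<^sup>+x. ?r (x + h) + ?r x \<partial>lborel) = (\<integral>\<^sup>+x. ?r (x + h) \<partial>lborel) + integral\<^sup>N lborel ?r"
      by (rule nn_integral_add) measurable
    also have "(\<integral>\<^sup>+x. ?r (x + h) \<partial>lborel) = integral\<^sup>N lborel ?r"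
      by (rule nn_integral_lborel_translate[of ?r h]) measurable
    also have "integral\<^sup>N lborel ?r + integral\<^sup>N lborel ?r + (\<integral>\<^sup>+x. ennreal \<bar>s i (x + h) - s i x\<bar> \<partial>lborel)
      < ennreal (e / 4) + ennreal (e / 4) + ennreal (e / 2)"
      by (intro add_strict_mono i d(2) h)
    also have "\<dots> = ennreal e"
      using lim.prems by (simp flip: ennreal_plus)
    finally show ?thesis .
  qed
  with d(1) show ?case by blast
qed

text \<open>
  Composition with this odd function carries \<open>L\<^sup>p\<close> into \<open>L\<^sup>1\<close>, which reduces
  continuity of translations in \<open>L\<^sup>p\<close> to the case \<open>p = 1\<close>.
\<close>

definition signed_powr :: "real \<Rightarrow> real \<Rightarrow> real" where
  "signed_powr p t = sgn t * \<bar>t\<bar> powr p"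

lemma powr_superadditive:
  fixes a b p :: real
  assumes "0 \<le> a" "0 \<le> b" "1 \<le> p"
  shows "a powr p + b powr p \<le> (a + b) powr p"
proof -
  have split: "t powr p = t * t powr (p - 1)" if "t \<ge> 0" for t :: real
    using that by (cases "t = 0") (simp_all add: powr_mult_base)
  have "a powr p + b powr p = a * a powr (p - 1) + b * b powr (p - 1)"
    using assms by (simp add: split)
  also have "\<dots> \<le> a * (a + b) powr (p - 1) + b * (a + b) powr (p - 1)"
    using assms by (intro add_mono mult_left_mono powr_mono2) auto
  also have "\<dots> = (a + b) powr p"
    using assms by (simp add: split distrib_right)
  finally show ?thesis .
qed

text \<open>
  For arguments of equal sign this is superadditivity of \<open>t powr p\<close>;
  for opposite signs both sides concern \<open>\<bar>a\<bar> + \<bar>b\<bar>\<close>, which is at most twice the larger summand.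
\<close>

lemma abs_diff_powr_le_signed_powr:
  fixes a b p :: real
  assumes "1 \<le> p"
  shows "\<bar>a - b\<bar> powr p \<le> 2 powr p * \<bar>signed_powr p a - signed_powr p b\<bar>"
proof -
  have two: "t \<le> 2 powr p * t" if "t \<ge> 0" for t :: real
    using mult_right_mono[of 1 "2 powr p" t] that assms ge_one_powr_ge_zero[of 2 p] by simp
  have same: "\<bar>x - y\<bar> powr p \<le> \<bar>x powr p - y powr p\<bar>" if "x \<ge> 0" "y \<ge> 0" for x y :: real
    using powr_superadditive[of y "x - y" p] powr_superadditive[of x "y - x" p] that assms
    by (cases "x \<ge> y") auto
  have opp: "(x + y) powr p \<le> 2 powr p * (x powr p + y powr p)" if "x \<ge> 0" "y \<ge> 0" for x y :: real
    using powr_abs_diff_le[of p x "- y"] that assms by simp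
  consider "a \<ge> 0" "b \<ge> 0" | "a < 0" "b < 0" | "a \<ge> 0" "b < 0" | "a < 0" "b \<ge> 0" by linarith
  then show ?thesis
  proof cases
    case 1
    then show ?thesis
      using order_trans[OF same[of a b] two] by (cases "a = 0"; cases "b = 0") (auto simp: signed_powr_def)
  next
    case 2
    then show ?thesis
      using order_trans[OF same[of "- a" "- b"] two] by (simp add: signed_powr_def abs_minus_commute)
  next
    case 3
    then show ?thesis
      using opp[of a "- b"] by (cases "a = 0") (auto simp: signed_powr_def)
  next
    case 4
    then show ?thesis
      using opp[of "- a" b] by (cases "b = 0") (auto simp: signed_powr_def abs_minus_commute add.commute)
  qed
qed

lemma translation_continuous_Lp:
  fixes f :: "'a::euclidean_space \<Rightarrow> real" and e p :: real
  assumes p: "1 \<le> p" and [measurable]: "f \<in> borel_measurable borel"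
    and fin: "(\<integral>\<^sup>+x. ennreal (\<bar>f x\<bar> powr p) \<partial>lborel) < \<infinity>" and e: "e > 0"
  obtains d where "d > 0"
    "\<And>h. norm h < d \<Longrightarrow> (\<integral>\<^sup>+x. ennreal (\<bar>f x - f (x - h)\<bar> powr p) \<partial>lborel) \<le> ennreal e"
proof -
  let ?F = "\<lambda>x. signed_powr p (f x)"
  have meas [measurable]: "?F \<in> borel_measurable borel"
    unfolding signed_powr_def by measurable
  have "\<bar>?F x\<bar> = \<bar>f x\<bar> powr p" for x
    by (auto simp: signed_powr_def abs_mult sgn_if)
  then have "integrable lborel ?F"
    using fin by (simp add: integrable_iff_bounded)
  moreover have "e / 2 powr p > 0" using e by simp
  ultimately obtain d where d: "d > 0" "\<And>h. norm h < d \<Longrightarrow>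
      (\<integral>\<^sup>+x. ennreal \<bar>?F (x + h) - ?F x\<bar> \<partial>lborel) < ennreal (e / 2 powr p)"
    using translation_continuous_L1 by blast
  show ?thesis
  proof
    fix h :: 'a assume h: "norm h < d"
    have "(\<integral>\<^sup>+x. ennreal (\<bar>f x - f (x - h)\<bar> powr p) \<partial>lborel)
        \<le> (\<integral>\<^sup>+x. ennreal (2 powr p) * ennreal \<bar>?F (x + - h) - ?F x\<bar> \<partial>lborel)"
      using abs_diff_powr_le_signed_powr[OF p]
      by (intro nn_integral_mono) (simp add: abs_minus_commute flip: ennreal_mult)
    also have "\<dots> = ennreal (2 powr p) * (\<integral>\<^sup>+x. ennreal \<bar>?F (x + - h) - ?F x\<bar> \<partial>lborel)"
      by (rule nn_integral_cmult) measurable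
    also have "\<dots> \<le> ennreal (2 powr p) * ennreal (e / 2 powr p)"
      using d(2)[of "- h"] h by (intro mult_left_mono) auto
    also have "\<dots> = ennreal e"
      using e by (simp flip: ennreal_mult')
    finally show "(\<integral>\<^sup>+x. ennreal (\<bar>f x - f (x - h)\<bar> powr p) \<partial>lborel) \<le> ennreal e" .
  qed (rule d(1))
qed

section \<open>Averages of translates\<close>

text \<open>
  The graph of \<open>t powr p\<close> lies above its tangent at \<open>m\<close>. The constant term of the tangent is moved
  to the other side, so that the inequality can be integrated in the extended nonnegative reals, where
  subtraction misbehaves. It is an instance of Young's inequality.
\<close>

lemma powr_above_tangent:
  fixes m t p :: real
  assumes "1 < p" "0 \<le> m" "0 \<le> t"
  shows "p * m powr (p - 1) * t \<le> t powr p + (p - 1) * m powr p"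
proof -
  have "t * m powr (p - 1) \<le> t powr p / p + (m powr (p - 1)) powr (p / (p - 1)) / (p / (p - 1))"
    using assms by (intro Youngs_inequality) (auto simp: field_simps)
  also have "\<dots> = t powr p / p + m powr p * (p - 1) / p"
    using assms by (simp add: powr_powr)
  finally show ?thesis
    using assms by (simp add: field_simps)
qed

text \<open>
  Jensen's inequality follows by integrating the tangent inequality at the mean \<open>m\<close>.
\<close>

lemma nn_integral_powr_jensen:
  fixes g :: "'a \<Rightarrow> real"
  assumes M: "emeasure M (space M) = 1" and [measurable]: "g \<in> borel_measurable M"
    and g: "\<And>x. 0 \<le> g x" and p: "1 < p"
    and m: "(\<integral>\<^sup>+x. ennreal (g x) \<partial>M) = ennreal m" "0 \<le> m"
  shows "ennreal (m powr p) \<le> (\<integral>\<^sup>+x. ennreal (g x powr p) \<partial>M)"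
proof -
  let ?c = "ennreal ((p - 1) * m powr p)"
  have "m powr (p - 1) * m = m powr p"
    using m(2) by (cases "m = 0") (simp_all add: powr_mult_base mult.commute)
  then have "m powr p + (p - 1) * m powr p = p * m powr (p - 1) * m"
    by (simp add: left_diff_distrib mult.assoc)
  then have "ennreal (m powr p) + ?c = ennreal (p * m powr (p - 1)) * (\<integral>\<^sup>+x. ennreal (g x) \<partial>M)"
    using p m by (simp del: mult.assoc flip: ennreal_plus ennreal_mult)
  also have "\<dots> = (\<integral>\<^sup>+x. ennreal (p * m powr (p - 1) * g x) \<partial>M)"
    using p g by (simp add: ennreal_mult flip: nn_integral_cmult)
  also have "\<dots> \<le> (\<integral>\<^sup>+x. ennreal (g x powr p) + ?c \<partial>M)"
    using powr_above_tangent[OF p m(2) g] p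
    by (intro nn_integral_mono) (simp flip: ennreal_plus add: ennreal_leI)
  also have "\<dots> = (\<integral>\<^sup>+x. ennreal (g x powr p) \<partial>M) + ?c"
    by (simp add: nn_integral_add M)
  finally show ?thesis
    by (simp add: ennreal_add_left_cancel_le add.commute)
qed

text \<open>
  Jensen's inequality at each point \<open>x\<close>, followed by exchange of the integrals. The map \<open>T\<close> allows
  translations along a subspace: the case of interest besides the identity is the diagonal shift
  \<open>h \<mapsto> (h, h)\<close> of a product space.
\<close>

lemma averaged_translations_Lp:
  fixes f :: "'a::euclidean_space \<Rightarrow> real" and T :: "'b \<Rightarrow> 'a"
  assumes M: "emeasure M (space M) = 1" and [measurable]: "T \<in> M \<rightarrow>\<^sub>M borel"
    and [measurable]: "f \<in> borel_measurable borel" and p: "1 < p"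
    and int: "\<And>x. integrable M (\<lambda>h. f (x - T h))"
    and le: "AE h in M. (\<integral>\<^sup>+x. ennreal (\<bar>f x - f (x - T h)\<bar> powr p) \<partial>lborel) \<le> c"
  shows "(\<integral>\<^sup>+x. ennreal (\<bar>f x - (\<integral>h. f (x - T h) \<partial>M)\<bar> powr p) \<partial>lborel) \<le> c"
proof -
  interpret M: finite_measure M by (rule finite_measureI) (simp add: M)
  interpret pair_sigma_finite lborel M ..
  have one: "measure M (space M) = 1" using M by (simp add: measure_def)
  have "ennreal (\<bar>f x - (\<integral>h. f (x - T h) \<partial>M)\<bar> powr p)
      \<le> (\<integral>\<^sup>+h. ennreal (\<bar>f x - f (x - T h)\<bar> powr p) \<partial>M)" for x
  proof -
    have i: "integrable M (\<lambda>h. f x - f (x - T h))"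
      using int by simp
    have "f x - (\<integral>h. f (x - T h) \<partial>M) = (\<integral>h. f x - f (x - T h) \<partial>M)"
      using int by (simp add: one)
    also have "\<bar>\<dots>\<bar> \<le> (\<integral>h. \<bar>f x - f (x - T h)\<bar> \<partial>M)"
      using integral_norm_bound[of M "\<lambda>h. f x - f (x - T h)"] by simp
    finally have "ennreal (\<bar>f x - (\<integral>h. f (x - T h) \<partial>M)\<bar> powr p) \<le> ennreal ((\<integral>h. \<bar>f x - f (x - T h)\<bar> \<partial>M) powr p)"
      using p by (intro ennreal_leI powr_mono2) auto
    also have "\<dots> \<le> (\<integral>\<^sup>+h. ennreal (\<bar>f x - f (x - T h)\<bar> powr p) \<partial>M)"
      using i by (intro nn_integral_powr_jensen[OF M _ _ p] nn_integral_eq_integral) auto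
    finally show ?thesis .
  qed
  then have "(\<integral>\<^sup>+x. ennreal (\<bar>f x - (\<integral>h. f (x - T h) \<partial>M)\<bar> powr p) \<partial>lborel)
      \<le> (\<integral>\<^sup>+x. (\<integral>\<^sup>+h. ennreal (\<bar>f x - f (x - T h)\<bar> powr p) \<partial>M) \<partial>lborel)"
    by (rule nn_integral_mono)
  also have "\<dots> = (\<integral>\<^sup>+h. (\<integral>\<^sup>+x. ennreal (\<bar>f x - f (x - T h)\<bar> powr p) \<partial>lborel) \<partial>M)"
    by (rule Fubini'[symmetric]) measurable
  also have "\<dots> \<le> (\<integral>\<^sup>+h. c \<partial>M)"
    using le by (rule nn_integral_mono_AE)
  also have "\<dots> = c" by (simp add: M)
  finally show ?thesis .
qed

section \<open>The moment of the logarithmic kernel\<close>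

lemma dyadic_scale_exists:
  fixes t :: real
  assumes "0 < t" "t \<le> 1"
  obtains j :: nat where "2 powr - real j / 2 < t" "t \<le> 2 powr - real j"
proof -
  define j where "j = nat \<lfloor>- log 2 t\<rfloor>"
  have "log 2 t \<le> 0" using assms by simp
  then have j: "real j \<le> - log 2 t" "- log 2 t < real j + 1"
    unfolding j_def by linarith+
  have "t = 2 powr log 2 t" using assms by simp
  moreover have "2 powr (- real j - 1) < 2 powr log 2 t" "2 powr log 2 t \<le> 2 powr - real j"
    using j by (auto intro!: powr_less_mono)
  ultimately show ?thesis
    using that[of j] by (simp add: powr_diff)
qed

text \<open>
  On the dyadic shell of outer radius \<open>r j = 2 powr - j\<close> the integrand is at most a constant times
  \<open>r j powr (a - N)\<close>. Replacing each shell by the full ball, of volume proportional to \<open>r j powr N\<close>,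
  gives a convergent geometric series with ratio \<open>2 powr - a\<close>.
\<close>

lemma nn_integral_norm_powr_finite:
  fixes a :: real
  assumes a: "a > 0"
  shows "(\<integral>\<^sup>+z. ennreal (indicator (ball 0 1) z * norm z powr (a - real DIM('a))) \<partial>(lborel :: 'a::euclidean_space measure)) < \<infinity>"
proof -
  let ?N = "real DIM('a)"
  define C where "C = 2 powr \<bar>a - ?N\<bar>"
  define r where "r j = 2 powr - real j" for j :: nat
  define G where "G j z = ennreal (C * r j powr (a - ?N)) * indicator (cball 0 (r j)) z" for j and z :: 'a
  have r: "r j > 0" for j by (simp add: r_def)
  have C: "C \<ge> 1" unfolding C_def by (rule ge_one_powr_ge_zero) auto
  have "ennreal (indicator (ball 0 1) z * norm z powr (a - ?N)) \<le> (\<Sum>j. G j z)" for z :: 'a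
  proof (cases "z \<noteq> 0 \<and> norm z < 1")
    case True
    \<comment> \<open>pass to the ratio \<open>q\<close> in \<open>(1 / 2, 1]\<close>, on which a power is bounded by \<open>C\<close> whatever the sign of its exponent\<close>
    then obtain j where j: "r j / 2 < norm z" "norm z \<le> r j"
      unfolding r_def using dyadic_scale_exists[of "norm z"] by auto
    define q where "q = norm z / r j"
    have q: "1 / 2 < q" "q \<le> 1" using j r[of j] by (auto simp: q_def field_simps)
    have "q powr (a - ?N) \<le> C"
    proof (cases "a \<ge> ?N")
      case True
      then have "q powr (a - ?N) \<le> 1 powr (a - ?N)" using q by (intro powr_mono2) auto
      with C show ?thesis by simp
    next
      case False
      then have "q powr (a - ?N) \<le> (1 / 2) powr (a - ?N)" using q by (intro powr_mono2') auto
      also have "\<dots> = C" using False by (simp add: C_def powr_divide powr_minus flip: powr_minus_divide)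
      finally show ?thesis .
    qed
    then have "q powr (a - ?N) * r j powr (a - ?N) \<le> C * r j powr (a - ?N)"
      by (intro mult_right_mono) auto
    moreover have "norm z powr (a - ?N) = q powr (a - ?N) * r j powr (a - ?N)"
      using r[of j] q by (subst powr_mult[symmetric]) (auto simp: q_def)
    ultimately have "ennreal (indicator (ball 0 1) z * norm z powr (a - ?N)) \<le> G j z"
      using True j by (auto simp: G_def intro!: ennreal_leI)
    also have "\<dots> \<le> (\<Sum>j. G j z)"
      using sum_le_suminf[of "\<lambda>j. G j z" "{j}"] by simp
    finally show ?thesis .
  qed auto
  then have "(\<integral>\<^sup>+z. ennreal (indicator (ball 0 1) z * norm z powr (a - ?N)) \<partial>(lborel :: 'a measure))
      \<le> (\<integral>\<^sup>+z. (\<Sum>j. G j z) \<partial>lborel)"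
    by (rule nn_integral_mono)
  also have "\<dots> = (\<Sum>j. \<integral>\<^sup>+z. G j z \<partial>lborel)"
  proof (rule nn_integral_suminf)
    show "G j \<in> borel_measurable lborel" for j
      unfolding G_def by (intro borel_measurable_times_ennreal borel_measurable_const borel_measurable_indicator) simp
  qed
  also have "(\<lambda>j. \<integral>\<^sup>+z. G j z \<partial>lborel) = (\<lambda>j. ennreal (C * unit_ball_vol ?N * (2 powr - a) ^ j))"
  proof
    fix j
    have "(\<integral>\<^sup>+z. G j z \<partial>lborel) = ennreal (C * r j powr (a - ?N)) * ennreal (unit_ball_vol ?N * r j ^ DIM('a))"
      unfolding G_def using r[of j]
      by (subst nn_integral_cmult_indicator) (auto simp: emeasure_cball)
    also have "\<dots> = ennreal (C * unit_ball_vol ?N * (r j powr (a - ?N) * r j powr ?N))"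
      using C r[of j] by (simp add: powr_realpow ac_simps flip: ennreal_mult)
    also have "r j powr (a - ?N) * r j powr ?N = r j powr a"
      by (simp flip: powr_add)
    also have "r j powr a = (2 powr - a) ^ j"
      by (simp add: r_def powr_powr mult.commute flip: powr_realpow)
    finally show "(\<integral>\<^sup>+z. G j z \<partial>lborel) = ennreal (C * unit_ball_vol ?N * (2 powr - a) ^ j)" .
  qed
  also have "(\<Sum>j. ennreal (C * unit_ball_vol ?N * (2 powr - a) ^ j)) < \<infinity>"
  proof -
    have "2 powr - a < 1" using a by (simp add: powr_less_one)
    then have "summable (\<lambda>j. C * unit_ball_vol ?N * (2 powr - a) ^ j)"
      by (intro summable_mult summable_geometric) simp
    then show ?thesis
      using C by (simp add: ennreal_suminf_neq_top less_top)
  qed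
  finally show ?thesis .
qed

lemma neg_ln_le_powr:
  fixes t \<delta> :: real
  assumes "0 < t" "0 < \<delta>"
  shows "- ln t \<le> t powr - \<delta> / \<delta>"
proof -
  have "\<delta> * (- ln t) = ln (t powr - \<delta>)" using assms by (simp add: ln_powr)
  also have "\<dots> \<le> t powr - \<delta>" using assms ln_le_minus_one[of "t powr - \<delta>"] by simp
  finally show ?thesis using assms by (simp add: field_simps)
qed

text \<open>
  The moment has the integrand \<open>\<bar>z\<bar> powr (p - s p - N)\<close> times a logarithm, on the unit ball.
  Half of the positive number \<open>p - s p\<close> pays for the logarithm, and the other half keeps the remaining
  power integrable.
\<close>

lemma log_kernel_moment_finite:
  fixes s p :: real
  assumes sp: "0 < s" "s < 1" "1 < p"
  shows "(\<integral>\<^sup>+z. ennreal (norm z powr p * log_kernel s p z) \<partial>(lborel :: (real ^ 'n) measure)) < \<infinity>"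
proof -
  define \<delta> where "\<delta> = (p - s * p) / 2"
  have "s * p < p" using sp by simp
  then have \<delta>: "\<delta> > 0" by (simp add: \<delta>_def)
  let ?N = "real CARD('n)"
  define c where "c = norm_const CARD('n) s p / \<delta>"
  have c: "c \<ge> 0" using norm_const_nonneg[OF sp] \<delta> by (simp add: c_def)
  have "norm z powr p * log_kernel s p z \<le> c * (indicator (ball 0 1) z * norm z powr (\<delta> - ?N))" for z :: "real ^ 'n"
  proof (cases "z \<noteq> 0 \<and> norm z < 1")
    case True
    then have z: "norm z > 0" "norm z < 1" by auto
    have "max 0 (- ln (norm z)) \<le> norm z powr - \<delta> / \<delta>"
      using neg_ln_le_powr[OF z(1) \<delta>] z \<delta> by simp
    then have "log_kernel s p z \<le> norm_const CARD('n) s p * (norm z powr - \<delta> / \<delta>) / norm z powr (?N + s * p)"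
      unfolding log_kernel_def using norm_const_nonneg[OF sp]
      by (intro divide_right_mono mult_left_mono) auto
    then have "norm z powr p * log_kernel s p z
      \<le> norm z powr p * (norm_const CARD('n) s p * (norm z powr - \<delta> / \<delta>) / norm z powr (?N + s * p))"
      by (intro mult_left_mono) auto
    also have "\<dots> = c * (norm z powr p * norm z powr - \<delta> / norm z powr (?N + s * p))"
      by (simp add: c_def)
    also have "norm z powr p * norm z powr - \<delta> / norm z powr (?N + s * p) = norm z powr (p - \<delta> - (?N + s * p))"
      using z by (simp add: powr_diff powr_minus divide_inverse)
    also have "p - \<delta> - (?N + s * p) = \<delta> - ?N"
      by (simp add: \<delta>_def field_simps)
    finally show ?thesis using z by simp
  qed (auto simp: log_kernel_def c)
  then have "(\<integral>\<^sup>+z. ennreal (norm z powr p * log_kernel s p z) \<partial>(lborel :: (real ^ 'n) measure))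
    \<le> (\<integral>\<^sup>+z. ennreal c * ennreal (indicator (ball 0 1) z * norm z powr (\<delta> - ?N)) \<partial>(lborel :: (real ^ 'n) measure))"
    using c by (intro nn_integral_mono) (simp flip: ennreal_mult add: ennreal_leI)
  also have "\<dots> = ennreal c * (\<integral>\<^sup>+z. ennreal (indicator (ball 0 1) z * norm z powr (\<delta> - ?N)) \<partial>(lborel :: (real ^ 'n) measure))"
  proof (rule nn_integral_cmult)
    have [measurable]: "ball 0 1 \<in> sets (borel :: (real ^ 'n) measure)" by simp
    show "(\<lambda>z::real ^ 'n. ennreal (indicator (ball 0 1) z * norm z powr (\<delta> - ?N))) \<in> borel_measurable lborel"
      by measurable
  qed
  also have "\<dots> < \<infinity>"
    using nn_integral_norm_powr_finite[OF \<delta>, where 'a = "real ^ 'n"] by (simp add: ennreal_mult_less_top)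
  finally show ?thesis .
qed

section \<open>The p-th power of the norm\<close>

lemma measurable_fst_borel: "fst \<in> borel_measurable (borel :: ('a::euclidean_space \<times> 'b::euclidean_space) measure)"
  and measurable_snd_borel: "snd \<in> borel_measurable (borel :: ('a::euclidean_space \<times> 'b::euclidean_space) measure)"
  by (auto intro!: borel_measurable_continuous_onI continuous_intros)

text \<open>
  The \<open>p\<close>-th power of the norm, kept extended-valued so that finiteness can be concluded
  from estimates.
\<close>

definition Wlog_energy :: "real \<Rightarrow> real \<Rightarrow> (real ^ 'n \<Rightarrow> real) \<Rightarrow> ennreal" where
  "Wlog_energy s p u = Lp_norm_pow p u + log_seminorm_pow s p u"

lemma Lp_norm_pow_lborel: "Lp_norm_pow p u = (\<integral>\<^sup>+x. ennreal (\<bar>u x\<bar> powr p) \<partial>lborel)"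
  by (simp add: Lp_norm_pow_def nn_integral_completion)

lemma log_seminorm_pow_lborel: "log_seminorm_pow s p u =
    (\<integral>\<^sup>+z. ennreal (\<bar>u (fst z) - u (snd z)\<bar> powr p * log_kernel s p (fst z - snd z)) \<partial>lborel)"
  by (simp add: log_seminorm_pow_def nn_integral_completion split_def)

lemma log_integrand_borel_measurable:
  assumes [measurable]: "u \<in> borel_measurable borel"
  shows "(\<lambda>z. \<bar>u (fst z) - u (snd z)\<bar> powr p * log_kernel s p (fst z - snd z)) \<in> borel_measurable borel"
proof -
  note [measurable] = measurable_fst_borel measurable_snd_borel
  show ?thesis by measurable
qed

text \<open>
  A null set times the whole space is a null set of the product. This is what makes the double
  integral insensitive to the choice of a representative.
\<close>

lemma AE_lborel_fst_snd:
  fixes P :: "'a::euclidean_space \<Rightarrow> bool"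
  assumes "AE x in lborel. P x"
  shows "AE z in lborel. P (fst (z :: 'a \<times> 'a))" "AE z in lborel. P (snd (z :: 'a \<times> 'a))"
proof -
  from assms obtain M where M: "{x. \<not> P x} \<subseteq> M" "M \<in> null_sets lborel"
    by (auto elim!: AE_E simp: null_sets_def)
  have "M \<times> UNIV \<in> null_sets (lborel \<Otimes>\<^sub>M (lborel :: 'a measure))"
    "UNIV \<times> M \<in> null_sets ((lborel :: 'a measure) \<Otimes>\<^sub>M lborel)"
    using M(2) lborel.emeasure_pair_measure_Times[of M lborel UNIV]
      lborel.emeasure_pair_measure_Times[of UNIV lborel M]
    by (auto simp: null_sets_def)
  then have N: "M \<times> UNIV \<in> null_sets (lborel :: ('a \<times> 'a) measure)"
    "UNIV \<times> M \<in> null_sets (lborel :: ('a \<times> 'a) measure)"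
    by (simp_all add: lborel_prod)
  show "AE z in lborel. P (fst (z :: 'a \<times> 'a))"
    using M(1) by (intro AE_I'[OF N(1)]) auto
  show "AE z in lborel. P (snd (z :: 'a \<times> 'a))"
    using M(1) by (intro AE_I'[OF N(2)]) auto
qed

lemma Wlog_energy_cong_AE:
  assumes "AE x in lborel. u x = v x"
  shows "Wlog_energy s p u = Wlog_energy s p v"
proof -
  have "Lp_norm_pow p u = Lp_norm_pow p v"
    unfolding Lp_norm_pow_lborel using assms by (intro nn_integral_cong_AE) auto
  moreover have "log_seminorm_pow s p u = log_seminorm_pow s p v"
    unfolding log_seminorm_pow_lborel
    using AE_lborel_fst_snd[OF assms] by (intro nn_integral_cong_AE) auto
  ultimately show ?thesis by (simp add: Wlog_energy_def)
qed

lemma Wlog_energy_diff_le: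
  fixes u v :: "real ^ 'n \<Rightarrow> real"
  assumes sp: "0 < s" "s < 1" "1 < p"
    and [measurable]: "u \<in> borel_measurable borel" "v \<in> borel_measurable borel"
  shows "Wlog_energy s p (\<lambda>x. u x - v x) \<le> ennreal (2 powr p) * (Wlog_energy s p u + Wlog_energy s p v)"
proof -
  let ?c = "ennreal (2 powr p)"
  have "Lp_norm_pow p (\<lambda>x. u x - v x)
      \<le> (\<integral>\<^sup>+x. ?c * (ennreal (\<bar>u x\<bar> powr p) + ennreal (\<bar>v x\<bar> powr p)) \<partial>lborel)"
    unfolding Lp_norm_pow_lborel using powr_abs_diff_le[of p] sp
    by (intro nn_integral_mono) (simp flip: ennreal_plus ennreal_mult)
  also have "\<dots> = ?c * (Lp_norm_pow p u + Lp_norm_pow p v)"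
    unfolding Lp_norm_pow_lborel by (simp add: nn_integral_cmult nn_integral_add)
  finally have Lp: "Lp_norm_pow p (\<lambda>x. u x - v x) \<le> ?c * (Lp_norm_pow p u + Lp_norm_pow p v)" .
  let ?g = "\<lambda>w z. \<bar>w (fst z) - w (snd z)\<bar> powr p * log_kernel s p (fst z - snd z)"
  have le: "ennreal (?g (\<lambda>x. u x - v x) z) \<le> ?c * (ennreal (?g u z) + ennreal (?g v z))" for z
  proof -
    let ?k = "log_kernel s p (fst z - snd z)"
    have k: "?k \<ge> 0" by (rule log_kernel_nonneg[OF sp])
    have "?g (\<lambda>x. u x - v x) z
        \<le> 2 powr p * (\<bar>u (fst z) - u (snd z)\<bar> powr p + \<bar>v (fst z) - v (snd z)\<bar> powr p) * ?k"
      using powr_abs_diff_le[of p "u (fst z) - u (snd z)" "v (fst z) - v (snd z)"] sp k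
      by (intro mult_right_mono) (auto simp: algebra_simps)
    also have "\<dots> = 2 powr p * (?g u z + ?g v z)"
      by (simp add: algebra_simps)
    finally show ?thesis
      using k by (simp add: ennreal_leI flip: ennreal_plus ennreal_mult)
  qed
  note [measurable] = log_integrand_borel_measurable[of u p s] log_integrand_borel_measurable[of v p s]
  have "log_seminorm_pow s p (\<lambda>x. u x - v x) \<le> (\<integral>\<^sup>+z. ?c * (ennreal (?g u z) + ennreal (?g v z)) \<partial>lborel)"
    unfolding log_seminorm_pow_lborel by (rule nn_integral_mono) (rule le)
  also have "\<dots> = ?c * (log_seminorm_pow s p u + log_seminorm_pow s p v)"
    unfolding log_seminorm_pow_lborel by (simp add: nn_integral_cmult nn_integral_add)
  finally have "Wlog_energy s p (\<lambda>x. u x - v x)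
      \<le> ?c * (Lp_norm_pow p u + Lp_norm_pow p v) + ?c * (log_seminorm_pow s p u + log_seminorm_pow s p v)"
    unfolding Wlog_energy_def by (rule add_mono[OF Lp])
  also have "\<dots> = ?c * (Wlog_energy s p u + Wlog_energy s p v)"
    unfolding Wlog_energy_def by (simp add: distrib_left ac_simps)
  finally show ?thesis .
qed

section \<open>Test functions have finite norm\<close>

text \<open>
  The type argument carries the dimension, which the value depends on.
\<close>

definition log_moment :: "real \<Rightarrow> real \<Rightarrow> 'n::finite itself \<Rightarrow> ennreal" where
  "log_moment s p (_ :: 'n::finite itself) =
     (\<integral>\<^sup>+z. ennreal (norm z powr p * log_kernel s p z) \<partial>(lborel :: (real ^ 'n) measure))"

lemma log_moment_finite: "0 < s \<Longrightarrow> s < 1 \<Longrightarrow> 1 < p \<Longrightarrow> log_moment s p TYPE('n::finite) < \<infinity>"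
  unfolding log_moment_def by (rule log_kernel_moment_finite)

lemma log_kernel_minus: "log_kernel s p (- z) = log_kernel s p z"
  by (simp add: log_kernel_def)

lemma nn_integral_lborel_iterated:
  fixes f :: "'a::euclidean_space \<times> 'b::euclidean_space \<Rightarrow> ennreal"
  assumes "f \<in> borel_measurable borel"
  shows "integral\<^sup>N lborel f = (\<integral>\<^sup>+x. (\<integral>\<^sup>+y. f (x, y) \<partial>lborel) \<partial>lborel)"
    and "integral\<^sup>N lborel f = (\<integral>\<^sup>+y. (\<integral>\<^sup>+x. f (x, y) \<partial>lborel) \<partial>lborel)"
proof -
  have f: "f \<in> borel_measurable (lborel \<Otimes>\<^sub>M lborel)"
    using assms by (simp add: lborel_prod)
  show "integral\<^sup>N lborel f = (\<integral>\<^sup>+x. (\<integral>\<^sup>+y. f (x, y) \<partial>lborel) \<partial>lborel)"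
    using lborel.nn_integral_fst[OF f] by (simp add: lborel_prod)
  show "integral\<^sup>N lborel f = (\<integral>\<^sup>+y. (\<integral>\<^sup>+x. f (x, y) \<partial>lborel) \<partial>lborel)"
    using lborel_pair.nn_integral_snd[OF f] by (simp add: lborel_prod)
qed

text \<open>
  Integrating first over the variable that the weight does not depend on, translation
  invariance turns the inner integral into the moment; for the second identity the evenness of the
  kernel is used as well.
\<close>

lemma nn_integral_weight_log_kernel:
  fixes w :: "real ^ 'n \<Rightarrow> ennreal"
  assumes [measurable]: "w \<in> borel_measurable borel"
  shows "(\<integral>\<^sup>+z. w (snd z) * ennreal (norm (fst z - snd z) powr p * log_kernel s p (fst z - snd z)) \<partial>lborel)
      = integral\<^sup>N lborel w * log_moment s p TYPE('n)" (is "?A = _")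
    and "(\<integral>\<^sup>+z. w (fst z) * ennreal (norm (fst z - snd z) powr p * log_kernel s p (fst z - snd z)) \<partial>lborel)
      = integral\<^sup>N lborel w * log_moment s p TYPE('n)" (is "?B = _")
proof -
  let ?m = "\<lambda>z::real ^ 'n. ennreal (norm z powr p * log_kernel s p z)"
  note [measurable] = measurable_fst_borel measurable_snd_borel
  have m [measurable]: "?m \<in> borel_measurable borel" by measurable
  have "(\<lambda>z::(real ^ 'n) \<times> (real ^ 'n). fst z - snd z) \<in> borel_measurable borel"
    by measurable
  from measurable_compose[OF this m]
  have [measurable]: "(\<lambda>z::(real ^ 'n) \<times> (real ^ 'n). ?m (fst z - snd z)) \<in> borel_measurable borel" .
  have [measurable]: "(\<lambda>z::(real ^ 'n) \<times> (real ^ 'n). w (fst z)) \<in> borel_measurable borel"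
    by (rule measurable_compose[OF measurable_fst_borel assms])
  have [measurable]: "(\<lambda>z::(real ^ 'n) \<times> (real ^ 'n). w (snd z)) \<in> borel_measurable borel"
    by (rule measurable_compose[OF measurable_snd_borel assms])
  have shift: "(\<integral>\<^sup>+x. ?m (x - y) \<partial>lborel) = log_moment s p TYPE('n)" for y
    using nn_integral_lborel_translate[OF m, of "- y"] by (simp add: log_moment_def)
  have even: "?m (x - y) = ?m (y - x)" for x y
    using log_kernel_minus[of s p "x - y"] by (simp add: norm_minus_commute)
  have "?A = (\<integral>\<^sup>+y. (\<integral>\<^sup>+x. w y * ?m (x - y) \<partial>lborel) \<partial>lborel)"
    by (subst nn_integral_lborel_iterated(2)) (auto intro!: borel_measurable_times_ennreal)
  also have "\<dots> = integral\<^sup>N lborel w * log_moment s p TYPE('n)"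
    by (simp add: nn_integral_cmult nn_integral_multc shift)
  finally show "?A = integral\<^sup>N lborel w * log_moment s p TYPE('n)" .
  have "?B = (\<integral>\<^sup>+x. (\<integral>\<^sup>+y. w x * ?m (x - y) \<partial>lborel) \<partial>lborel)"
    by (subst nn_integral_lborel_iterated(1)) (auto intro!: borel_measurable_times_ennreal)
  also have "\<dots> = (\<integral>\<^sup>+x. (\<integral>\<^sup>+y. w x * ?m (y - x) \<partial>lborel) \<partial>lborel)"
    by (simp only: even)
  also have "\<dots> = integral\<^sup>N lborel w * log_moment s p TYPE('n)"
    by (simp add: nn_integral_cmult nn_integral_multc shift)
  finally show "?B = integral\<^sup>N lborel w * log_moment s p TYPE('n)" .
qed

text \<open>
  The double integrand vanishes unless one of the two points lies in the support, and the Lipschitz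
  bound leaves the moment of the kernel to be integrated against the indicator of the support.
\<close>

lemma Cc_infinity_subset_Wlog:
  fixes \<phi> :: "real ^ 'n \<Rightarrow> real"
  assumes sp: "0 < s" "s < 1" "1 < p" and \<phi>: "\<phi> \<in> Cc_infinity"
  shows "\<phi> \<in> Wlog s p"
proof -
  define K where "K = closure {x. \<phi> x \<noteq> 0}"
  have K: "compact K" using \<phi> by (simp add: K_def Cc_infinity_def)
  have [measurable]: "K \<in> sets borel" by (simp add: K_def)
  have out: "\<phi> x = 0" if "x \<notin> K" for x
    using that closure_subset[of "{x. \<phi> x \<noteq> 0}"] by (auto simp: K_def)
  have fin: "emeasure lborel K < \<infinity>" by (rule emeasure_compact_finite[OF K])
  obtain B where B: "B \<ge> 0" "\<And>x. \<bar>\<phi> x\<bar> \<le> B" using Cc_infinity_bounded[OF \<phi>] by metis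
  obtain L where L: "L \<ge> 0" "\<And>x y. \<bar>\<phi> x - \<phi> y\<bar> \<le> L * norm (x - y)"
    using Cc_infinity_derivative_bounded[OF \<phi>] Cc_infinity_lipschitz[OF \<phi>] by metis
  have "Lp_norm_pow p \<phi> \<le> (\<integral>\<^sup>+x. ennreal (B powr p) * indicator K x \<partial>lborel)"
    unfolding Lp_norm_pow_lborel
  proof (rule nn_integral_mono)
    show "ennreal (\<bar>\<phi> x\<bar> powr p) \<le> ennreal (B powr p) * indicator K x" for x
      using B sp out[of x] by (cases "x \<in> K") (auto intro!: ennreal_leI powr_mono2)
  qed
  also have "\<dots> < \<infinity>"
    using fin by (simp add: nn_integral_cmult_indicator ennreal_mult_less_top)
  finally have Lp: "Lp_norm_pow p \<phi> < \<infinity>" .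
  let ?m = "\<lambda>z::(real ^ 'n) \<times> (real ^ 'n). ennreal (norm (fst z - snd z) powr p * log_kernel s p (fst z - snd z))"
  let ?c = "ennreal (L powr p)"
  note [measurable] = measurable_fst_borel measurable_snd_borel
  have "log_seminorm_pow s p \<phi> \<le> (\<integral>\<^sup>+z. ?c * (indicator K (fst z) * ?m z + indicator K (snd z) * ?m z) \<partial>lborel)"
    unfolding log_seminorm_pow_lborel
  proof (rule nn_integral_mono)
    fix z :: "(real ^ 'n) \<times> (real ^ 'n)"
    let ?k = "log_kernel s p (fst z - snd z)"
    have k: "?k \<ge> 0" by (rule log_kernel_nonneg[OF sp])
    show "ennreal (\<bar>\<phi> (fst z) - \<phi> (snd z)\<bar> powr p * ?k)
        \<le> ?c * (indicator K (fst z) * ?m z + indicator K (snd z) * ?m z)"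
    proof (cases "fst z \<in> K \<or> snd z \<in> K")
      case True
      have "\<bar>\<phi> (fst z) - \<phi> (snd z)\<bar> powr p \<le> (L * norm (fst z - snd z)) powr p"
        using L sp by (intro powr_mono2) auto
      also have "\<dots> = L powr p * norm (fst z - snd z) powr p"
        using L by (simp add: powr_mult)
      finally have "ennreal (\<bar>\<phi> (fst z) - \<phi> (snd z)\<bar> powr p * ?k)
          \<le> ennreal (L powr p * norm (fst z - snd z) powr p * ?k)"
        using k by (intro ennreal_leI mult_right_mono)
      also have "\<dots> = ?c * ?m z"
        using k by (simp add: mult.assoc flip: ennreal_mult)
      also have "\<dots> \<le> ?c * (indicator K (fst z) * ?m z + indicator K (snd z) * ?m z)"
        using True by (intro mult_left_mono) (auto simp: indicator_def)
      finally show ?thesis .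
    qed (simp add: out)
  qed
  also have "\<dots> = ?c * ((\<integral>\<^sup>+z. indicator K (fst z) * ?m z \<partial>lborel) + (\<integral>\<^sup>+z. indicator K (snd z) * ?m z \<partial>lborel))"
    by (simp add: nn_integral_cmult nn_integral_add)
  also have "\<dots> = ?c * (emeasure lborel K * log_moment s p TYPE('n) + emeasure lborel K * log_moment s p TYPE('n))"
    by (simp add: nn_integral_weight_log_kernel)
  also have "\<dots> < \<infinity>"
    using fin log_moment_finite[OF sp, where 'n = 'n] by (simp add: ennreal_mult_less_top)
  finally have "log_seminorm_pow s p \<phi> < \<infinity>" .
  with Lp show ?thesis
    using Cc_infinity_measurable[OF \<phi>] by (simp add: Wlog_def measurable_completion)
qed

section \<open>Truncation\<close>

text \<open>
  A Lipschitz cutoff is sufficient, as the truncated function is mollified afterwards.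
\<close>

definition cutoff :: "nat \<Rightarrow> 'a::euclidean_space \<Rightarrow> real" where
  "cutoff n x = max 0 (1 - norm x / real (Suc n))"

lemma cutoff_measurable [measurable]: "cutoff n \<in> borel_measurable borel"
  unfolding cutoff_def by measurable

lemma cutoff_bounds: "0 \<le> cutoff n x" "cutoff n x \<le> 1"
  by (auto simp: cutoff_def)

lemma cutoff_lipschitz: "\<bar>cutoff n x - cutoff n y\<bar> \<le> norm (x - y) / real (Suc n)"
proof -
  have "\<bar>cutoff n x - cutoff n y\<bar> \<le> \<bar>norm x / real (Suc n) - norm y / real (Suc n)\<bar>"
    unfolding cutoff_def by linarith
  also have "\<dots> = \<bar>norm x - norm y\<bar> / real (Suc n)"
    by (simp flip: diff_divide_distrib)
  also have "\<dots> \<le> norm (x - y) / real (Suc n)"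
    by (intro divide_right_mono norm_triangle_ineq3) auto
  finally show ?thesis .
qed

lemma cutoff_tendsto: "(\<lambda>n. cutoff n x) \<longlonglongrightarrow> 1"
proof -
  have "(\<lambda>n. max 0 (1 - norm x / real (Suc n))) \<longlonglongrightarrow> max 0 (1 - 0)"
    by (intro tendsto_intros LIMSEQ_Suc[OF lim_const_over_n])
  then show ?thesis by (simp add: cutoff_def)
qed

lemma cutoff_zero: "norm x \<ge> real (Suc n) \<Longrightarrow> cutoff n x = 0"
  by (simp add: cutoff_def)

lemma nn_integral_cutoff_complement_tendsto:
  fixes g :: "'b \<Rightarrow> real" and q :: "'b \<Rightarrow> 'a::euclidean_space"
  assumes [measurable]: "g \<in> borel_measurable M" "q \<in> M \<rightarrow>\<^sub>M borel" and g: "\<And>x. 0 \<le> g x"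
    and p: "0 < p" and fin: "(\<integral>\<^sup>+x. ennreal (g x) \<partial>M) < \<infinity>"
  shows "(\<lambda>n. \<integral>\<^sup>+x. ennreal ((1 - cutoff n (q x)) powr p * g x) \<partial>M) \<longlonglongrightarrow> 0"
proof -
  have "(\<lambda>n. \<integral>\<^sup>+x. ennreal ((1 - cutoff n (q x)) powr p * g x) \<partial>M) \<longlonglongrightarrow> (\<integral>\<^sup>+x. 0 \<partial>M)"
  proof (rule nn_integral_dominated_convergence[where w = "\<lambda>x. ennreal (g x)"])
    fix n
    have "(1 - cutoff n (q x)) powr p * g x \<le> 1 * g x" for x
      using cutoff_bounds[of n "q x"] p by (intro mult_right_mono g powr_le1) auto
    then show "AE x in M. ennreal ((1 - cutoff n (q x)) powr p * g x) \<le> ennreal (g x)"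
      by (auto intro!: ennreal_leI)
  next
    have "(\<lambda>n. ennreal ((1 - cutoff n (q x)) powr p * g x)) \<longlonglongrightarrow> ennreal (0 * g x)" for x
    proof (intro tendsto_ennrealI tendsto_mult tendsto_const)
      have "(\<lambda>n. 1 - cutoff n (q x)) \<longlonglongrightarrow> 1 - 1"
        by (intro tendsto_intros cutoff_tendsto)
      then show "(\<lambda>n. (1 - cutoff n (q x)) powr p) \<longlonglongrightarrow> 0"
        using p cutoff_bounds
        by (intro tendsto_zero_powrI[of _ _ "\<lambda>_. p" p]) (auto intro!: always_eventually)
    qed
    then show "AE x in M. (\<lambda>n. ennreal ((1 - cutoff n (q x)) powr p * g x)) \<longlonglongrightarrow> 0"
      by simp
  qed (use fin in \<open>auto intro: measurable\<close>)
  then show ?thesis by simp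
qed

text \<open>
  With \<open>\<eta>\<close> the cutoff, the increment of \<open>(1 - \<eta>) u\<close> from \<open>y\<close> to \<open>x\<close> is
  \<open>(1 - \<eta> x) (u x - u y) - u y (\<eta> x - \<eta> y)\<close>. The first part is the increment of \<open>u\<close> with a bounded
  weight tending to 0 pointwise. The second is at most \<open>\<bar>u y\<bar> \<bar>x - y\<bar> / (n + 1)\<close>, which against the kernel
  integrates to a multiple of \<open>(1 / (n + 1)) powr p\<close>, by the finite moment.
\<close>

lemma Wlog_energy_cutoff_tendsto:
  fixes u :: "real ^ 'n \<Rightarrow> real"
  assumes sp: "0 < s" "s < 1" "1 < p" and [measurable]: "u \<in> borel_measurable borel"
    and fin: "Wlog_energy s p u < \<infinity>"
  shows "(\<lambda>n. Wlog_energy s p (\<lambda>x. u x - cutoff n x * u x)) \<longlonglongrightarrow> 0"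
proof -
  have Lpu: "Lp_norm_pow p u < \<infinity>" and su: "log_seminorm_pow s p u < \<infinity>"
    using fin by (auto simp: Wlog_energy_def)
  have fac: "u x - cutoff n x * u x = (1 - cutoff n x) * u x" for n x
    by (simp add: algebra_simps)
  have absfac: "\<bar>(1 - cutoff n x) * t\<bar> powr p = (1 - cutoff n x) powr p * \<bar>t\<bar> powr p" for n t and x :: "real ^ 'n"
    using cutoff_bounds[of n x] by (simp add: abs_mult powr_mult)
  have "(\<lambda>n. \<integral>\<^sup>+x. ennreal ((1 - cutoff n x) powr p * \<bar>u x\<bar> powr p) \<partial>lborel) \<longlonglongrightarrow> 0"
    using Lpu sp unfolding Lp_norm_pow_lborel
    by (intro nn_integral_cutoff_complement_tendsto) auto
  then have Lp: "(\<lambda>n. Lp_norm_pow p (\<lambda>x. u x - cutoff n x * u x)) \<longlonglongrightarrow> 0"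
    by (simp add: Lp_norm_pow_lborel fac absfac)

  let ?g = "\<lambda>z. \<bar>u (fst z) - u (snd z)\<bar> powr p * log_kernel s p (fst z - snd z)"
  let ?m = "\<lambda>z::(real ^ 'n) \<times> (real ^ 'n). ennreal (norm (fst z - snd z) powr p * log_kernel s p (fst z - snd z))"
  let ?A = "\<lambda>n z. ennreal ((1 - cutoff n (fst z)) powr p * ?g z)"
  let ?B = "\<lambda>z. ennreal (\<bar>u (snd z)\<bar> powr p) * ?m z"
  let ?c = "ennreal (2 powr p)"
  let ?r = "\<lambda>n. ennreal ((1 / real (Suc n)) powr p)"
  note [measurable] = measurable_fst_borel measurable_snd_borel
  have gm [measurable]: "?g \<in> borel_measurable borel"
    by (rule log_integrand_borel_measurable) simp
  have k: "log_kernel s p z \<ge> 0" for z :: "real ^ 'n" by (rule log_kernel_nonneg[OF sp])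
  have bound: "log_seminorm_pow s p (\<lambda>x. u x - cutoff n x * u x)
      \<le> ?c * (integral\<^sup>N lborel (?A n) + ?r n * (Lp_norm_pow p u * log_moment s p TYPE('n)))" for n
  proof -
    have "log_seminorm_pow s p (\<lambda>x. u x - cutoff n x * u x) \<le> (\<integral>\<^sup>+z. ?c * (?A n z + ?r n * ?B z) \<partial>lborel)"
      unfolding log_seminorm_pow_lborel
    proof (rule nn_integral_mono)
      fix z :: "(real ^ 'n) \<times> (real ^ 'n)"
      obtain x y where z: "z = (x, y)" by force
      let ?k = "log_kernel s p (x - y)"
      let ?a = "(1 - cutoff n x) * (u x - u y)" and ?b = "u y * (cutoff n x - cutoff n y)"
      have "\<bar>?b\<bar> powr p = \<bar>u y\<bar> powr p * \<bar>cutoff n x - cutoff n y\<bar> powr p"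
        by (simp add: abs_mult powr_mult)
      also have "\<dots> \<le> \<bar>u y\<bar> powr p * (norm (x - y) * (1 / real (Suc n))) powr p"
        using cutoff_lipschitz[of n x y] sp by (intro mult_left_mono powr_mono2) auto
      also have "\<dots> = (1 / real (Suc n)) powr p * (\<bar>u y\<bar> powr p * norm (x - y) powr p)"
        by (subst powr_mult) auto
      finally have b: "\<bar>?b\<bar> powr p \<le> (1 / real (Suc n)) powr p * (\<bar>u y\<bar> powr p * norm (x - y) powr p)" .
      have "(u x - cutoff n x * u x) - (u y - cutoff n y * u y) = ?a - ?b"
        by (simp add: algebra_simps)
      then have "\<bar>(u x - cutoff n x * u x) - (u y - cutoff n y * u y)\<bar> powr p
          \<le> 2 powr p * (\<bar>?a\<bar> powr p + \<bar>?b\<bar> powr p)"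
        using powr_abs_diff_le[of p ?a ?b] sp by simp
      also have "\<dots> \<le> 2 powr p * ((1 - cutoff n x) powr p * \<bar>u x - u y\<bar> powr p
          + (1 / real (Suc n)) powr p * (\<bar>u y\<bar> powr p * norm (x - y) powr p))"
        using b by (intro mult_left_mono add_mono) (auto simp: absfac)
      finally have "\<bar>(u x - cutoff n x * u x) - (u y - cutoff n y * u y)\<bar> powr p * ?k
          \<le> 2 powr p * ((1 - cutoff n x) powr p * \<bar>u x - u y\<bar> powr p
            + (1 / real (Suc n)) powr p * (\<bar>u y\<bar> powr p * norm (x - y) powr p)) * ?k"
        using k by (rule mult_right_mono)
      also have "\<dots> = 2 powr p * ((1 - cutoff n x) powr p * (\<bar>u x - u y\<bar> powr p * ?k)
            + (1 / real (Suc n)) powr p * (\<bar>u y\<bar> powr p * (norm (x - y) powr p * ?k)))"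
        by (simp add: algebra_simps)
      finally show "ennreal (\<bar>(u (fst z) - cutoff n (fst z) * u (fst z)) - (u (snd z) - cutoff n (snd z) * u (snd z))\<bar> powr p
          * log_kernel s p (fst z - snd z)) \<le> ?c * (?A n z + ?r n * ?B z)"
        using k[of "x - y"] unfolding z
        by (simp add: ennreal_leI flip: ennreal_plus ennreal_mult)
    qed
    also have "\<dots> = ?c * (integral\<^sup>N lborel (?A n) + ?r n * integral\<^sup>N lborel ?B)"
      by (simp add: nn_integral_cmult nn_integral_add)
    also have "integral\<^sup>N lborel ?B = Lp_norm_pow p u * log_moment s p TYPE('n)"
      unfolding Lp_norm_pow_lborel by (rule nn_integral_weight_log_kernel(1)) measurable
    finally show ?thesis .
  qed
  have "(\<lambda>n. integral\<^sup>N lborel (?A n)) \<longlonglongrightarrow> 0"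
    using su sp k unfolding log_seminorm_pow_lborel
    by (intro nn_integral_cutoff_complement_tendsto) auto
  moreover have "(\<lambda>n. (Lp_norm_pow p u * log_moment s p TYPE('n)) * ?r n)
      \<longlonglongrightarrow> (Lp_norm_pow p u * log_moment s p TYPE('n)) * ennreal 0"
  proof (rule ennreal_tendsto_cmult)
    show "Lp_norm_pow p u * log_moment s p TYPE('n) < top"
      using Lpu log_moment_finite[OF sp, where 'n = 'n] by (simp add: ennreal_mult_less_top)
    have "(\<lambda>n. 1 / real (Suc n)) \<longlonglongrightarrow> 0"
      by (rule LIMSEQ_Suc[OF lim_const_over_n])
    then show "(\<lambda>n. ?r n) \<longlonglongrightarrow> ennreal 0"
      using sp by (intro tendsto_ennrealI tendsto_zero_powrI[of _ _ "\<lambda>_. p" p]) auto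
  qed
  ultimately have "(\<lambda>n. ?c * (integral\<^sup>N lborel (?A n) + ?r n * (Lp_norm_pow p u * log_moment s p TYPE('n))))
      \<longlonglongrightarrow> ?c * (0 + Lp_norm_pow p u * log_moment s p TYPE('n) * ennreal 0)"
    by (intro ennreal_tendsto_cmult tendsto_add) (simp_all add: mult.commute)
  then have lim: "(\<lambda>n. ?c * (integral\<^sup>N lborel (?A n) + ?r n * (Lp_norm_pow p u * log_moment s p TYPE('n))))
      \<longlonglongrightarrow> 0"
    by simp
  have "(\<lambda>n. log_seminorm_pow s p (\<lambda>x. u x - cutoff n x * u x)) \<longlonglongrightarrow> 0"
  proof (rule tendsto_sandwich[OF _ _ tendsto_const lim])
    show "\<forall>\<^sub>F n in sequentially. log_seminorm_pow s p (\<lambda>x. u x - cutoff n x * u x)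
      \<le> ?c * (integral\<^sup>N lborel (?A n) + ?r n * (Lp_norm_pow p u * log_moment s p TYPE('n)))"
      by (intro always_eventually allI bound)
  qed simp
  from tendsto_add[OF Lp this] show ?thesis
    by (simp add: Wlog_energy_def)
qed

section \<open>Mollification\<close>

lemma lborel_distr_reflect:
  fixes c :: "'a::euclidean_space"
  shows "distr lborel borel (\<lambda>x. c - x) = lborel"
  using lborel_affine[of "-1" c] by (simp add: density_1)

text \<open>
  The reflection \<open>h \<mapsto> x - h\<close> exchanges the two descriptions of a mollification: as an average of
  translates of \<open>v\<close>, suited to norm estimates, and as a convolution with \<open>v\<close> fixed, suited to
  differentiation.
\<close>

lemma mollifier_measure_integral:
  fixes \<rho> v :: "'a::euclidean_space \<Rightarrow> real"
  assumes \<rho>: "\<rho> \<in> Cc_infinity" "\<And>x. 0 \<le> \<rho> x" and v: "integrable lborel v"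
  shows "integrable (density lborel \<rho>) (\<lambda>h. v (x - h))"
    and "(\<integral>h. v (x - h) \<partial>density lborel \<rho>) = (\<integral>y. \<rho> (x - y) * v y \<partial>lborel)"
proof -
  have [measurable]: "\<rho> \<in> borel_measurable borel" "v \<in> borel_measurable borel"
    using Cc_infinity_measurable[OF \<rho>(1)] borel_measurable_integrable[OF v] by auto
  have "integrable (distr lborel borel (\<lambda>h. x - h)) (\<lambda>y. \<rho> (x - y) * v y)"
    unfolding lborel_distr_reflect by (rule convolution_integrable[OF \<rho>(1) v])
  then have "integrable lborel (\<lambda>h. \<rho> h * v (x - h))"
    by (subst (asm) integrable_distr_eq) auto
  then show "integrable (density lborel \<rho>) (\<lambda>h. v (x - h))"
    using \<rho>(2) by (subst integrable_density) auto
  have "(\<integral>y. \<rho> (x - y) * v y \<partial>lborel) = (\<integral>y. \<rho> (x - y) * v y \<partial>distr lborel borel (\<lambda>h. x - h))"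
    unfolding lborel_distr_reflect ..
  also have "\<dots> = (\<integral>h. \<rho> h * v (x - h) \<partial>lborel)"
    by (subst integral_distr) auto
  also have "\<dots> = (\<integral>h. v (x - h) \<partial>density lborel \<rho>)"
    using \<rho>(2) by (subst integral_density) auto
  finally show "(\<integral>h. v (x - h) \<partial>density lborel \<rho>) = (\<integral>y. \<rho> (x - y) * v y \<partial>lborel)" ..
qed

text \<open>
  On the product space let \<open>f\<close> be the increment of \<open>v\<close> times the \<open>p\<close>-th root of the kernel, so that
  the seminorm of \<open>v\<close> is the \<open>L\<^sup>p\<close> norm of \<open>f\<close>. Averaging \<open>f\<close> over diagonal shifts gives the function that
  belongs in the same way to the mollification of \<open>v\<close>. One mollifier with small support therefore controls
  both parts of the norm.
\<close>

lemma Wlog_energy_mollify: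
  fixes v :: "real ^ 'n \<Rightarrow> real" and e :: real
  assumes sp: "0 < s" "s < 1" "1 < p" and v: "integrable lborel v"
    and fin: "Wlog_energy s p v < \<infinity>" and e: "e > 0"
  obtains \<rho> where "\<rho> \<in> Cc_infinity"
    "Wlog_energy s p (\<lambda>x. v x - (\<integral>y. \<rho> (x - y) * v y \<partial>lborel)) \<le> ennreal e"
proof -
  have vm [measurable]: "v \<in> borel_measurable borel"
    using borel_measurable_integrable[OF v] by simp
  have Lpv: "Lp_norm_pow p v < \<infinity>" and sv: "log_seminorm_pow s p v < \<infinity>"
    using fin by (auto simp: Wlog_energy_def)
  note [measurable] = measurable_fst_borel measurable_snd_borel
  define \<kappa> where "\<kappa> z = log_kernel s p z powr (1 / p)" for z :: "real ^ 'n"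
  have \<kappa>: "\<kappa> z \<ge> 0" "\<kappa> z powr p = log_kernel s p z" for z
    using sp log_kernel_nonneg[OF sp, of z] by (auto simp: \<kappa>_def powr_powr)
  define f where "f z = (v (fst z) - v (snd z)) * \<kappa> (fst z - snd z)" for z
  have powr_f: "\<bar>t * \<kappa> z\<bar> powr p = \<bar>t\<bar> powr p * log_kernel s p z" for t z
    using \<kappa>[of z] by (simp add: abs_mult powr_mult)
  have fm [measurable]: "f \<in> borel_measurable borel"
    unfolding f_def \<kappa>_def by measurable
  have p1: "1 \<le> p" and e2: "e / 2 > 0" using sp e by auto
  obtain d where d: "d > 0"
    "\<And>h. norm h < d \<Longrightarrow> (\<integral>\<^sup>+x. ennreal (\<bar>v x - v (x - h)\<bar> powr p) \<partial>lborel) \<le> ennreal (e / 2)"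
    using translation_continuous_Lp[OF p1 vm Lpv[unfolded Lp_norm_pow_lborel] e2] by blast
  have "(\<integral>\<^sup>+z. ennreal (\<bar>f z\<bar> powr p) \<partial>lborel) < \<infinity>"
    using sv unfolding log_seminorm_pow_lborel f_def powr_f .
  from translation_continuous_Lp[OF p1 fm this e2] obtain d' where d': "d' > 0"
    "\<And>h. norm h < d' \<Longrightarrow> (\<integral>\<^sup>+z. ennreal (\<bar>f z - f (z - h)\<bar> powr p) \<partial>lborel) \<le> ennreal (e / 2)"
    by blast
  \<comment> \<open>the diagonal shift \<open>(h, h)\<close> may be up to twice as long as \<open>h\<close>\<close>
  define r where "r = min d (d' / 2)"
  have "r > 0" using d d' by (simp add: r_def)
  then obtain \<rho> :: "real ^ 'n \<Rightarrow> real" where \<rho>: "\<rho> \<in> Cc_infinity" "\<And>x. 0 \<le> \<rho> x"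
    "\<And>x. \<rho> x \<noteq> 0 \<Longrightarrow> norm x < r" "integral\<^sup>L lborel \<rho> = 1"
    using mollifier_exists by metis
  have [measurable]: "\<rho> \<in> borel_measurable borel"
    by (rule Cc_infinity_measurable[OF \<rho>(1)])
  let ?M = "density lborel (\<lambda>x. ennreal (\<rho> x))"
  have "emeasure ?M (space ?M) = (\<integral>\<^sup>+x. ennreal (\<rho> x) \<partial>lborel)"
    by (simp add: emeasure_density)
  also have "\<dots> = 1"
    using nn_integral_eq_integral[OF Cc_infinity_integrable[OF \<rho>(1)]] \<rho> by simp
  finally have M: "emeasure ?M (space ?M) = 1" .
  have supp: "AE h in ?M. norm h < r"
    using \<rho>(3) by (subst AE_density) auto
  define w where "w x = (\<integral>y. \<rho> (x - y) * v y \<partial>lborel)" for x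
  have vi: "integrable ?M (\<lambda>h. v (x - h))" and w: "(\<integral>h. v (x - h) \<partial>?M) = w x" for x
    using mollifier_measure_integral[OF \<rho>(1,2) v] by (auto simp: w_def)
  have "Lp_norm_pow p (\<lambda>x. v x - w x) = (\<integral>\<^sup>+x. ennreal (\<bar>v x - (\<integral>h. v (x - h) \<partial>?M)\<bar> powr p) \<partial>lborel)"
    by (simp add: Lp_norm_pow_lborel w)
  also have "\<dots> \<le> ennreal (e / 2)"
  proof (rule averaged_translations_Lp[OF M _ vm sp(3) vi])
    show "AE h in ?M. (\<integral>\<^sup>+x. ennreal (\<bar>v x - v (x - h)\<bar> powr p) \<partial>lborel) \<le> ennreal (e / 2)"
      using supp by eventually_elim (auto intro: d(2) simp: r_def)
  qed simp
  finally have Lp: "Lp_norm_pow p (\<lambda>x. v x - w x) \<le> ennreal (e / 2)" .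
  have shift: "f (z - (h, h)) = v (fst z - h) * \<kappa> (fst z - snd z) - v (snd z - h) * \<kappa> (fst z - snd z)" for z h
    by (simp add: f_def left_diff_distrib)
  have fi: "integrable ?M (\<lambda>h. f (z - (h, h)))" for z
    unfolding shift using vi by (intro Bochner_Integration.integrable_diff integrable_mult_left) auto
  have avg: "(\<integral>h. f (z - (h, h)) \<partial>?M) = (w (fst z) - w (snd z)) * \<kappa> (fst z - snd z)" for z
    unfolding shift using vi w by (simp add: left_diff_distrib)
  have "\<bar>f z - (\<integral>h. f (z - (h, h)) \<partial>?M)\<bar> powr p
      = \<bar>(v (fst z) - w (fst z)) - (v (snd z) - w (snd z))\<bar> powr p * log_kernel s p (fst z - snd z)" for z
    unfolding avg unfolding powr_f[symmetric] f_def by (simp add: algebra_simps)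
  then have "log_seminorm_pow s p (\<lambda>x. v x - w x)
      = (\<integral>\<^sup>+z. ennreal (\<bar>f z - (\<integral>h. f (z - (h, h)) \<partial>?M)\<bar> powr p) \<partial>lborel)"
    by (simp add: log_seminorm_pow_lborel)
  also have "\<dots> \<le> ennreal (e / 2)"
  proof (rule averaged_translations_Lp[OF M _ fm sp(3) fi])
    have hh: "norm (h, h) < d'" if "norm h < r" for h :: "real ^ 'n"
      using that norm_Pair_le[of h h] by (simp add: r_def)
    show "AE h in ?M. (\<integral>\<^sup>+z. ennreal (\<bar>f z - f (z - (h, h))\<bar> powr p) \<partial>lborel) \<le> ennreal (e / 2)"
      using supp by eventually_elim (rule d'(2)[OF hh])
    have "(\<lambda>h::real ^ 'n. (h, h)) \<in> borel_measurable borel"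
      by (intro borel_measurable_continuous_onI continuous_intros)
    then show "(\<lambda>h. (h, h)) \<in> borel_measurable ?M"
      by simp
  qed
  finally have "Wlog_energy s p (\<lambda>x. v x - w x) \<le> ennreal (e / 2) + ennreal (e / 2)"
    unfolding Wlog_energy_def by (rule add_mono[OF Lp])
  also have "\<dots> = ennreal e" using e by (simp flip: ennreal_plus)
  finally show ?thesis using \<rho>(1) that unfolding w_def by blast
qed

section \<open>Density\<close>

lemma Wlog_energy_diff_commute: "Wlog_energy s p (\<lambda>x. u x - v x) = Wlog_energy s p (\<lambda>x. v x - u x)"
proof -
  have "\<bar>u x - v x - (u y - v y)\<bar> = \<bar>v x - u x - (v y - u y)\<bar>" for x y by linarith
  then show ?thesis
    by (simp add: Wlog_energy_def Lp_norm_pow_lborel log_seminorm_pow_lborel abs_minus_commute)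
qed

text \<open>
  On the compact set, \<open>t \<le> 1 + t powr p\<close> for \<open>t \<ge> 0\<close> trades the exponent \<open>p\<close> for 1 at the price of
  the finite measure of the set.
\<close>

lemma integrable_bounded_support:
  fixes v :: "'a::euclidean_space \<Rightarrow> real"
  assumes [measurable]: "v \<in> borel_measurable borel" and p: "1 < p"
    and fin: "(\<integral>\<^sup>+x. ennreal (\<bar>v x\<bar> powr p) \<partial>lborel) < \<infinity>"
    and K: "compact K" "\<And>x. v x \<noteq> 0 \<Longrightarrow> x \<in> K"
  shows "integrable lborel v"
proof -
  have [measurable]: "K \<in> sets borel" using K(1) by (simp add: borel_compact)
  have "ennreal \<bar>v x\<bar> \<le> indicator K x + ennreal (\<bar>v x\<bar> powr p)" for x
  proof (cases "v x = 0")
    case False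
    have "\<bar>v x\<bar> \<le> 1 + \<bar>v x\<bar> powr p"
    proof (cases "\<bar>v x\<bar> \<le> 1")
      case False
      then have "\<bar>v x\<bar> powr 1 \<le> \<bar>v x\<bar> powr p" using p by (intro powr_mono) auto
      then show ?thesis using False by simp
    qed (simp add: add_increasing2)
    then have "ennreal \<bar>v x\<bar> \<le> ennreal 1 + ennreal (\<bar>v x\<bar> powr p)"
      by (simp flip: ennreal_plus add: ennreal_leI del: ennreal_1)
    then show ?thesis using K(2)[OF False] by simp
  qed simp
  then have "(\<integral>\<^sup>+x. ennreal \<bar>v x\<bar> \<partial>lborel) \<le> (\<integral>\<^sup>+x. indicator K x + ennreal (\<bar>v x\<bar> powr p) \<partial>lborel)"
    by (rule nn_integral_mono)
  also have "\<dots> = emeasure lborel K + (\<integral>\<^sup>+x. ennreal (\<bar>v x\<bar> powr p) \<partial>lborel)"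
    by (simp add: nn_integral_add)
  also have "\<dots> < \<infinity>"
    using fin emeasure_compact_finite[OF K(1)] by simp
  finally show ?thesis by (simp add: integrable_iff_bounded)
qed

text \<open>
  Truncation comes first because it provides integrability and bounded support, which make the
  subsequent convolution with a mollifier a test function.
\<close>

lemma Cc_infinity_dense_borel:
  fixes u :: "real ^ 'n \<Rightarrow> real" and e :: real
  assumes sp: "0 < s" "s < 1" "1 < p" and [measurable]: "u \<in> borel_measurable borel"
    and fin: "Wlog_energy s p u < \<infinity>" and e: "e > 0"
  obtains \<phi> where "\<phi> \<in> Cc_infinity" "Wlog_energy s p (\<lambda>x. u x - \<phi> x) < ennreal e"
proof -
  \<comment> \<open>two errors below \<open>\<delta>\<close> are added with the quasi-triangle constant \<open>2 powr p\<close>, and a factor 2 gives strictness\<close>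
  define \<delta> where "\<delta> = e / (2 powr p * 4)"
  have \<delta>: "\<delta> > 0" "2 powr p * (\<delta> + \<delta>) < e" using e by (auto simp: \<delta>_def field_simps)
  have "\<forall>\<^sub>F n in sequentially. Wlog_energy s p (\<lambda>x. u x - cutoff n x * u x) < ennreal \<delta>"
    using Wlog_energy_cutoff_tendsto[OF sp _ fin] \<delta>(1) by (intro order_tendstoD(2)[of _ 0]) auto
  then obtain n where n: "Wlog_energy s p (\<lambda>x. u x - cutoff n x * u x) < ennreal \<delta>"
    by (auto simp: eventually_sequentially)
  define v where "v x = cutoff n x * u x" for x
  have vm [measurable]: "v \<in> borel_measurable borel" unfolding v_def by measurable
  have uv: "Wlog_energy s p (\<lambda>x. u x - v x) < ennreal \<delta>" using n by (simp add: v_def)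
  have "Wlog_energy s p (\<lambda>x. u x - (u x - v x))
      \<le> ennreal (2 powr p) * (Wlog_energy s p u + Wlog_energy s p (\<lambda>x. u x - v x))"
    by (rule Wlog_energy_diff_le[OF sp]) measurable
  also have "\<dots> < \<infinity>"
    using fin less_trans[OF uv ennreal_less_top] by (simp add: ennreal_mult_less_top)
  finally have vfin: "Wlog_energy s p v < \<infinity>" by simp
  have K: "v x \<noteq> 0 \<Longrightarrow> x \<in> cball 0 (real (Suc n))" for x
    using cutoff_zero[of n x] by (force simp: v_def not_le)
  have vi: "integrable lborel v"
    using vfin by (intro integrable_bounded_support[OF vm sp(3) _ compact_cball K])
      (auto simp: Wlog_energy_def Lp_norm_pow_lborel)
  obtain \<rho> where \<rho>: "\<rho> \<in> Cc_infinity"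
    "Wlog_energy s p (\<lambda>x. v x - (\<integral>y. \<rho> (x - y) * v y \<partial>lborel)) \<le> ennreal \<delta>"
    using Wlog_energy_mollify[OF sp vi vfin \<delta>(1)] by blast
  define \<phi> where "\<phi> x = (\<integral>y. \<rho> (x - y) * v y \<partial>lborel)" for x
  have \<phi>: "\<phi> \<in> Cc_infinity"
    unfolding \<phi>_def[abs_def] by (rule convolution_Cc_infinity[OF \<rho>(1) vi compact_cball K])
  have [measurable]: "\<phi> \<in> borel_measurable borel" by (rule Cc_infinity_measurable[OF \<phi>])
  have "Wlog_energy s p (\<lambda>x. (u x - v x) - (\<phi> x - v x))
      \<le> ennreal (2 powr p) * (Wlog_energy s p (\<lambda>x. u x - v x) + Wlog_energy s p (\<lambda>x. \<phi> x - v x))"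
    by (rule Wlog_energy_diff_le[OF sp]) measurable
  also have "\<dots> \<le> ennreal (2 powr p) * (ennreal \<delta> + ennreal \<delta>)"
    using uv \<rho>(2) Wlog_energy_diff_commute[of s p \<phi> v]
    by (intro mult_left_mono add_mono) (auto simp: \<phi>_def less_imp_le)
  also have "\<dots> = ennreal (2 powr p * (\<delta> + \<delta>))"
    using \<delta>(1) by (simp flip: ennreal_plus ennreal_mult)
  also have "\<dots> < ennreal e"
    using \<delta> e by (intro ennreal_lessI)
  finally show ?thesis using \<phi> that by simp
qed

theorem theorem4p4:
  fixes s p :: real
  assumes "1 < p" and "0 < s" and "s < 1"
  shows "(Cc_infinity :: (real ^ 'n \<Rightarrow> real) set) \<subseteq> Wlog s p \<and>
    (\<forall>u \<in> (Wlog s p :: (real ^ 'n \<Rightarrow> real) set). \<forall>\<epsilon>>0.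
       \<exists>\<phi> \<in> Cc_infinity. Wlog_norm s p (\<lambda>x. u x - \<phi> x) < \<epsilon>)"
proof (intro conjI ballI allI impI)
  note sp = assms(2,3,1)
  show "(Cc_infinity :: (real ^ 'n \<Rightarrow> real) set) \<subseteq> Wlog s p"
    using Cc_infinity_subset_Wlog[OF sp] by blast
  fix u :: "real ^ 'n \<Rightarrow> real" and \<epsilon> :: real
  assume u: "u \<in> Wlog s p" and \<epsilon>: "\<epsilon> > 0"
  from u have "u \<in> borel_measurable lebesgue" by (simp add: Wlog_def)
  \<comment> \<open>Borel functions can be composed with the projections and shifts of the product space\<close>
  then obtain u' where u': "u' \<in> borel_measurable borel" "AE x in lborel. u x = u' x"
    using completion_ex_borel_measurable_real[of u lborel] by auto
  have "Wlog_energy s p u' < \<infinity>"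
    using u unfolding Wlog_energy_cong_AE[OF u'(2), of s p, symmetric] by (simp add: Wlog_def Wlog_energy_def)
  moreover have "\<epsilon> powr p > 0" using \<epsilon> by simp
  ultimately obtain \<phi> where \<phi>: "\<phi> \<in> Cc_infinity"
    "Wlog_energy s p (\<lambda>x. u' x - \<phi> x) < ennreal (\<epsilon> powr p)"
    using Cc_infinity_dense_borel[OF sp u'(1)] by blast
  have "Wlog_energy s p (\<lambda>x. u x - \<phi> x) = Wlog_energy s p (\<lambda>x. u' x - \<phi> x)"
    using u'(2) by (intro Wlog_energy_cong_AE) auto
  with \<phi>(2) have "Wlog_energy s p (\<lambda>x. u x - \<phi> x) < ennreal (\<epsilon> powr p)" by simp
  then have "enn2real (Wlog_energy s p (\<lambda>x. u x - \<phi> x)) < \<epsilon> powr p"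
    by (cases "Wlog_energy s p (\<lambda>x. u x - \<phi> x)") (auto simp: ennreal_less_iff)
  then have "Wlog_norm s p (\<lambda>x. u x - \<phi> x) < (\<epsilon> powr p) powr (1 / p)"
    unfolding Wlog_norm_def Wlog_energy_def using assms by (intro powr_less_mono2) auto
  also have "\<dots> = \<epsilon>"
    using \<epsilon> assms by (simp add: powr_powr)
  finally show "\<exists>\<phi> \<in> Cc_infinity. Wlog_norm s p (\<lambda>x. u x - \<phi> x) < \<epsilon>"
    using \<phi>(1) by blast
qed

end
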